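(* Let $B_1,\dots,B_b$ be a collection of disjoint subsets of $E$, let $\{d_i\mid i\in[b]\}$ be integers, let $n=|E|$, and let $\epsilon$ be the parameter of the Generalized Adaptive Stochastic Greedy policy $\pi^{gasg}$. If $f:2^E\times O^E\to\mathbb{R}_{\ge0}$ is fully adaptive submodular and adaptive monotone with respect to the prior $p$, then $$f_{avg}(\pi^{gasg})\ \ge\ \frac{1-1/e-\epsilon}{4-2/e-2\epsilon}\, f_{avg}(\pi^{opt}),$$ where $\pi^{opt}$ is an optimal policy under the partition matroid constraint given by the $B_i$ and $d_i$, and $\pi^{gasg}$ uses at most $O(n\log\frac1\epsilon)$ value oracle queries.
   Context: **Items, states, realizations.** $[m]=\{1,\dots,m\}$. $E$ is a set of $n$ items, $O$ is a set of states. A realization is a map $\phi:E\to O$. $\Phi$ is a random realization drawn from a known prior distribution $p(\phi)=\Pr[\Phi=\phi]$. A partial realization $\psi$ is a map from a subset $\mathrm{dom}(\psi)\subseteq E$ to $O$; $\phi\sim\psi$ means that $\phi$ agrees with $\psi$ on $\mathrm{dom}(\psi)$; $\psi\subseteq\psi'$ means $\mathrm{dom}(\psi)\subseteq\mathrm{dom}(\psi')$ and they agree on $\mathrm{dom}(\psi)$. Partial realizations are those with $\Pr[\Phi\sim\psi]>0$, so that conditioning on $\Phi\sim\psi$ makes sense. The utility function is $f:2^E\times O^E\to\mathbb{R}_{\ge0}$. **Policies.** A policy $\pi$ is a (possibly randomized) adaptive rule which, given the partial realization of the items selected so far, decides which item to select next (or to stop); the state of an item is observed after it is selected. $E(\pi,\phi)$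 is the set of items selected by $\pi$ under $\phi$, and $f_{avg}(\pi)=\mathbb{E}[f(E(\pi,\Phi),\Phi)]$, the expectation being over $\Phi\sim p$ and the internal randomness of $\pi$. The set of feasible policies (partition matroid constraint) is $\Omega=\{\pi\mid\forall\phi,\ \forall i\in[b],\ |E(\pi,\phi)\cap B_i|\le d_i\}$. $\pi^{opt}$ is a policy maximizing $f_{avg}$ over $\Omega$. **Marginal utilities.** $\Delta(e\mid\psi)=\mathbb{E}[f(\mathrm{dom}(\psi)\cup\{e\},\Phi)-f(\mathrm{dom}(\psi),\Phi)\mid\Phi\sim\psi]$ for an item $e$, and $\Delta(\pi\mid\psi)=\mathbb{E}[f(\mathrm{dom}(\psi)\cup E(\pi,\Phi),\Phi)-f(\mathrm{dom}(\psi),\Phi)\mid\Phi\sim\psi]$ for a policy $\pi$. A value oracle query returns $\Delta(e\mid\psi)$ for an item $e\in E$ and a partial realization $\psi$. $f$ is adaptive monotone with respect to $p$ if $\Delta(e\mid\psi)\ge0$ for all partial realizations $\psi$ and all $e\in E$. For $V\subseteq E$ and an integer $a\in[|V|]$, let $\Omega(V,a)$ be the set of policies which are allowed to select at most $a$ items, only from $V$. $f$ is fully adaptive submodular with respect to $p$ if for any two partial realizations $\psi\subseteq\psi'$, any $V\subseteq E$ and any $a\in[|V|]$, $\max_{\pi\in\Omega(V,a)}\Delta(\pi\mid\psi)\ge\max_{\pi\in\Omega(V,a)}\Delta(\pi\mid\psi')$. **Policy $\pi^{gasg}$.** Start with the empty set. For $i=1,\dots,b$ and, within each $i$, for $j=1,\dots,d_i$: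 observe the partial realization $\psi$ of all items selected so far; let $S_{ij}$ be a random set, with size $\frac{|B_i|}{d_i}\log\frac1\epsilon$, sampled uniformly at random from $B_i$; select an item in $\arg\max_{e\in S_{ij}}\Delta(e\mid\psi)$.
   Formalization: Feasible policies select only from the union of the B_i; sample sizes are rounded up and capped at |B_i|; the query bound assumes d_i ≤ |B_i|; 0<ε<1, and the O-constant is uniform for ε ≤ ε_0, for each fixed ε_0<1; expected utilities are assumed finite. *)

theory Defs
  imports "HOL-Probability.Probability"
begin

text \<open>
  Items form a finite set \<open>E\<close> and states a set \<open>Os\<close>. Realizations are the elements of
  \<open>E \<rightarrow>\<^sub>E Os\<close>; the prior is a pmf on them. Partial realizations are maps \<open>'e \<rightharpoonup> 'o\<close>,
  ordered by the library relation \<open>\<subseteq>\<^sub>m\<close>.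
\<close>

definition agrees :: "('e \<Rightarrow> 'o) \<Rightarrow> ('e \<rightharpoonup> 'o) \<Rightarrow> bool" where
  "agrees \<phi> \<psi> \<longleftrightarrow> (\<forall>e\<in>dom \<psi>. \<psi> e = Some (\<phi> e))"

definition partial_realizations :: "'e set \<Rightarrow> ('e \<Rightarrow> 'o) pmf \<Rightarrow> ('e \<rightharpoonup> 'o) set" where
  "partial_realizations E p =
     {\<psi>. dom \<psi> \<subseteq> E \<and> measure_pmf.prob p {\<phi>. agrees \<phi> \<psi>} > 0}"

text \<open>
  A policy is a well-founded randomized decision tree: at each node it stops, or selects an item and
  continues depending on the observed state, or tosses coins. A node thus knows the partial
  realization observed on the way to it. Selecting an item again has no effect on the selected set.
\<close>

datatype ('e, 'o) policy =
    Stop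
  | Select 'e "'o \<Rightarrow> ('e, 'o) policy"
  | Toss "('e, 'o) policy pmf"

text \<open>The random set \<open>E(\<pi>, \<phi>)\<close>.\<close>

primrec selected :: "('e, 'o) policy \<Rightarrow> ('e \<Rightarrow> 'o) \<Rightarrow> 'e set pmf" where
  "selected Stop \<phi> = return_pmf {}"
| "selected (Select e k) \<phi> = map_pmf (insert e) (selected (k (\<phi> e)) \<phi>)"
| "selected (Toss D) \<phi> = join_pmf (map_pmf (\<lambda>\<pi>. selected \<pi> \<phi>) D)"

definition f_avg :: "('e \<Rightarrow> 'o) pmf \<Rightarrow> ('e set \<Rightarrow> ('e \<Rightarrow> 'o) \<Rightarrow> real) \<Rightarrow> ('e, 'o) policy \<Rightarrow> real"
where
  "f_avg p f \<pi> = measure_pmf.expectation p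
     (\<lambda>\<phi>. measure_pmf.expectation (selected \<pi> \<phi>) (\<lambda>S. f S \<phi>))"

text \<open>
  Policies obeying the partition matroid constraint. The ground set of the matroid is
  \<open>\<Union>i\<in>{1..b}. B i\<close>: no other item may be selected. This is automatic if the \<open>B i\<close> cover \<open>E\<close>.
\<close>

definition feasible_policies ::
  "'e set \<Rightarrow> 'o set \<Rightarrow> nat \<Rightarrow> (nat \<Rightarrow> 'e set) \<Rightarrow> (nat \<Rightarrow> nat) \<Rightarrow> ('e, 'o) policy set" where
  "feasible_policies E Os b B d =
     {\<pi>. \<forall>\<phi>\<in>E \<rightarrow>\<^sub>E Os. \<forall>S\<in>set_pmf (selected \<pi> \<phi>).
        S \<subseteq> (\<Union>i\<in>{1..b}. B i) \<and> (\<forall>i\<in>{1..b}. card (S \<inter> B i) \<le> d i)}"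

definition policies_on :: "'e set \<Rightarrow> 'o set \<Rightarrow> 'e set \<Rightarrow> nat \<Rightarrow> ('e, 'o) policy set" where
  "policies_on E Os V a =
     {\<pi>. \<forall>\<phi>\<in>E \<rightarrow>\<^sub>E Os. \<forall>S\<in>set_pmf (selected \<pi> \<phi>). S \<subseteq> V \<and> card S \<le> a}"

definition item_gain ::
  "('e \<Rightarrow> 'o) pmf \<Rightarrow> ('e set \<Rightarrow> ('e \<Rightarrow> 'o) \<Rightarrow> real) \<Rightarrow> 'e \<Rightarrow> ('e \<rightharpoonup> 'o) \<Rightarrow> real" where
  "item_gain p f e \<psi> = measure_pmf.expectation (cond_pmf p {\<phi>. agrees \<phi> \<psi>})
     (\<lambda>\<phi>. f (dom \<psi> \<union> {e}) \<phi> - f (dom \<psi>) \<phi>)"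

definition policy_gain ::
  "('e \<Rightarrow> 'o) pmf \<Rightarrow> ('e set \<Rightarrow> ('e \<Rightarrow> 'o) \<Rightarrow> real) \<Rightarrow> ('e, 'o) policy \<Rightarrow> ('e \<rightharpoonup> 'o) \<Rightarrow> real" where
  "policy_gain p f \<pi> \<psi> = measure_pmf.expectation (cond_pmf p {\<phi>. agrees \<phi> \<psi>})
     (\<lambda>\<phi>. measure_pmf.expectation (selected \<pi> \<phi>) (\<lambda>S. f (dom \<psi> \<union> S) \<phi> - f (dom \<psi>) \<phi>))"

definition adaptive_monotone ::
  "'e set \<Rightarrow> ('e \<Rightarrow> 'o) pmf \<Rightarrow> ('e set \<Rightarrow> ('e \<Rightarrow> 'o) \<Rightarrow> real) \<Rightarrow> bool" where
  "adaptive_monotone E p f \<longleftrightarrow>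
     (\<forall>\<psi>\<in>partial_realizations E p. \<forall>e\<in>E. item_gain p f e \<psi> \<ge> 0)"

text \<open>
  The maxima over policies are written as suprema. They are attained, since \<open>E\<close> is finite, whenever
  every \<open>f S\<close> with \<open>S \<subseteq> E\<close> is integrable.
\<close>

definition fully_adaptive_submodular ::
  "'e set \<Rightarrow> 'o set \<Rightarrow> ('e \<Rightarrow> 'o) pmf \<Rightarrow> ('e set \<Rightarrow> ('e \<Rightarrow> 'o) \<Rightarrow> real) \<Rightarrow> bool" where
  "fully_adaptive_submodular E Os p f \<longleftrightarrow>
     (\<forall>\<psi>\<in>partial_realizations E p. \<forall>\<psi>'\<in>partial_realizations E p. \<psi> \<subseteq>\<^sub>m \<psi>' \<longrightarrow>
        (\<forall>V\<subseteq>E. \<forall>a\<in>{1..card V}.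
           (SUP \<pi>\<in>policies_on E Os V a. policy_gain p f \<pi> \<psi>)
             \<ge> (SUP \<pi>\<in>policies_on E Os V a. policy_gain p f \<pi> \<psi>')))"

text \<open>
  Algorithms access the utility function only through a value oracle: \<open>Query e \<psi> k\<close> asks for the
  value at \<open>(e, \<psi>)\<close> and continues with \<open>k\<close> applied to the answer. Fixing the oracle turns an
  algorithm into a policy.
\<close>

datatype ('e, 'o) alg =
    AStop
  | ASelect 'e "'o \<Rightarrow> ('e, 'o) alg"
  | AToss "('e, 'o) alg pmf"
  | Query 'e "'e \<rightharpoonup> 'o" "real \<Rightarrow> ('e, 'o) alg"

primrec policy_of :: "('e \<Rightarrow> ('e \<rightharpoonup> 'o) \<Rightarrow> real) \<Rightarrow> ('e, 'o) alg \<Rightarrow> ('e, 'o) policy" where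
  "policy_of orc AStop = Stop"
| "policy_of orc (ASelect e k) = Select e (\<lambda>s. policy_of orc (k s))"
| "policy_of orc (AToss D) = Toss (map_pmf (policy_of orc) D)"
| "policy_of orc (Query e \<psi> k) = policy_of orc (k (orc e \<psi>))"

text \<open>The random number of oracle queries in a run under \<open>\<phi>\<close>.\<close>

primrec num_queries ::
  "('e \<Rightarrow> ('e \<rightharpoonup> 'o) \<Rightarrow> real) \<Rightarrow> ('e, 'o) alg \<Rightarrow> ('e \<Rightarrow> 'o) \<Rightarrow> nat pmf" where
  "num_queries orc AStop \<phi> = return_pmf 0"
| "num_queries orc (ASelect e k) \<phi> = num_queries orc (k (\<phi> e)) \<phi>"
| "num_queries orc (AToss D) \<phi> = join_pmf (map_pmf (\<lambda>A. num_queries orc A \<phi>) D)"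
| "num_queries orc (Query e \<psi> k) \<phi> = map_pmf Suc (num_queries orc (k (orc e \<psi>)) \<phi>)"

primrec query_all ::
  "'e list \<Rightarrow> ('e \<rightharpoonup> 'o) \<Rightarrow> ('e \<Rightarrow> real) \<Rightarrow> (('e \<Rightarrow> real) \<Rightarrow> ('e, 'o) alg) \<Rightarrow> ('e, 'o) alg" where
  "query_all [] \<psi> v k = k v"
| "query_all (e # es) \<psi> v k = Query e \<psi> (\<lambda>r. query_all es \<psi> (v(e := r)) k)"

text \<open>
  The prescribed sample size \<open>|B\<^sub>i| / d\<^sub>i * log (1/\<epsilon>)\<close> need be neither an integer nor at most
  \<open>|B\<^sub>i|\<close>, so it is rounded up and capped.
\<close>

definition sample_size :: "'e set \<Rightarrow> nat \<Rightarrow> real \<Rightarrow> nat" where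
  "sample_size A k \<epsilon> = min (card A) (nat \<lceil>real (card A) / real k * ln (1 / \<epsilon>)\<rceil>)"

text \<open>
  \<open>tie i j \<psi> S v\<close> is the item selected in step \<open>(i, j)\<close> from the sample \<open>S\<close>, given the oracle
  answers \<open>v\<close>: an arbitrary element of the argmax.
\<close>

type_synonym ('e, 'o) tie_rule =
  "nat \<Rightarrow> nat \<Rightarrow> ('e \<rightharpoonup> 'o) \<Rightarrow> 'e set \<Rightarrow> ('e \<Rightarrow> real) \<Rightarrow> 'e"

definition argmax_rule :: "('e, 'o) tie_rule \<Rightarrow> bool" where
  "argmax_rule tie \<longleftrightarrow>
     (\<forall>i j \<psi> S v. finite S \<and> S \<noteq> {} \<longrightarrow> is_arg_max v (\<lambda>e. e \<in> S) (tie i j \<psi> S v))"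

text \<open>
  The list argument holds the remaining steps \<open>(i, j)\<close>, and \<open>\<psi>\<close> is the partial realization of the
  items selected so far. The items of a sample are queried in an unspecified order. A sample is
  empty only if \<open>B i\<close> is empty (for \<open>\<epsilon> < 1\<close>); the step is then void.
\<close>

primrec gasg_steps ::
  "(nat \<Rightarrow> 'e set) \<Rightarrow> (nat \<Rightarrow> nat) \<Rightarrow> real \<Rightarrow> ('e, 'o) tie_rule \<Rightarrow> (nat \<times> nat) list \<Rightarrow>
     ('e \<rightharpoonup> 'o) \<Rightarrow> ('e, 'o) alg" where
  "gasg_steps B d \<epsilon> tie [] \<psi> = AStop"
| "gasg_steps B d \<epsilon> tie (ij # ijs) \<psi> = (case ij of (i, j) \<Rightarrow>
     AToss (map_pmf
       (\<lambda>S. if S = {} then gasg_steps B d \<epsilon> tie ijs \<psi>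
            else query_all (SOME es. set es = S \<and> distinct es) \<psi> (\<lambda>_. 0)
              (\<lambda>v. let e = tie i j \<psi> S v
                   in ASelect e (\<lambda>s. gasg_steps B d \<epsilon> tie ijs (\<psi>(e \<mapsto> s)))))
       (pmf_of_set {S. S \<subseteq> B i \<and> card S = sample_size (B i) (d i) \<epsilon>})))"

definition gasg ::
  "nat \<Rightarrow> (nat \<Rightarrow> 'e set) \<Rightarrow> (nat \<Rightarrow> nat) \<Rightarrow> real \<Rightarrow> ('e, 'o) tie_rule \<Rightarrow> ('e, 'o) alg" where
  "gasg b B d \<epsilon> tie =
     gasg_steps B d \<epsilon> tie [(i, j). i \<leftarrow> [1..<Suc b], j \<leftarrow> [1..<Suc (d i)]] Map.empty"

end

theory Submission imports Defs begin

text \<open>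
  Work with partial realizations as states: the policy value \<open>val\<close> obeys a Bellman recursion in which
  \<open>after e\<close> averages over the state of \<open>e\<close>. Let \<open>D \<psi>\<close> be the gain of running the optimal policy on top
  of \<open>\<psi>\<close> and \<open>M\<^sub>i \<psi>\<close> the best gain of a policy selecting at most \<open>d\<^sub>i\<close> items of \<open>B\<^sub>i\<close>. By induction
  over policies, \<open>D \<le> \<Sum>\<^sub>i M\<^sub>i\<close>, and \<open>M\<^sub>i \<psi>\<close> is at most the sum of at most \<open>d\<^sub>i\<close> item gains at \<open>\<psi>\<close>, so
  that a greedy step in \<open>B\<^sub>i\<close> gains at least \<open>(1 - \<epsilon>) / d\<^sub>i * M\<^sub>i\<close> in expectation. Monotonicity bounds the
  decrease of \<open>D\<close> and \<open>M\<^sub>i\<close> in a step by the gain of the step, and submodularity makes \<open>M\<^sub>i\<close> decreasing.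
  With \<open>\<alpha> = 1 - 1/e - \<epsilon>\<close> these facts give, backwards over the steps, that \<open>1 + \<alpha>\<close> times the gain of the
  steps in the groups from \<open>i\<close> on is at least \<open>\<alpha> (D - (\<Sum>l<i. M\<^sub>l))\<close>. For \<open>i = 1\<close> this is the ratio
  \<open>\<alpha> / (1 + \<alpha>)\<close>, twice the one claimed.
\<close>

text \<open>The state set may be infinite and each \<open>f S\<close> is only integrable, so
  expectations need care: a Bochner integral is 0 by default when integrability fails. Everything is
  dominated by one function, the \<open>envelope\<close>, whose posterior mean averages to itself
  under every observation.

  The groups are treated in order, so D also counts items of earlier groups, from which the greedy
  policy no longer selects. Subtracting the M of those groups repairs this without harm to the
  recursion: these terms do not increase in expectation, so the difference still loses at most the
  gain of a step.

  The constant \<alpha> comes from balancing one group. With n steps of the group left, its M has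
  the coefficient \<beta> - \<alpha>, where \<beta> starts at 0 for n = 0 and becomes \<beta> + (1 -
  \<beta>) q with each further step, q being (1 - \<epsilon>) divided by the number of steps of the
  group.

  Full adaptive submodularity enters twice: for groups with their remaining budgets, and, with a
  single item and budget 1, for item gains.\<close>

section \<open>Expectations and integrability on discrete distributions\<close>

lemma
  fixes g :: "'b \<Rightarrow> real"
  assumes nonneg: "\<And>y. y \<in> set_pmf (bind_pmf M N) \<Longrightarrow> 0 \<le> g y"
    and int: "integrable (measure_pmf (bind_pmf M N)) g"
  shows expectation_bind_nonneg: "measure_pmf.expectation (bind_pmf M N) g =
      measure_pmf.expectation M (\<lambda>x. measure_pmf.expectation (N x) g)" (is ?eq)
    and integrable_expectation_bind_nonneg:
      "integrable (measure_pmf M) (\<lambda>x. measure_pmf.expectation (N x) g)" (is ?int)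
proof -
  have nonneg: "0 \<le> g y" if "x \<in> set_pmf M" "y \<in> set_pmf (N x)" for x y
    using nonneg that by auto
  have fin: "(\<integral>\<^sup>+x. \<integral>\<^sup>+y. ennreal (g y) \<partial>N x \<partial>M) < \<infinity>"
    using int nonneg
    by (subst nn_integral_bind_pmf[symmetric], subst nn_integral_eq_integral)
       (auto simp: AE_measure_pmf_iff)
  \<comment> \<open>For a pmf, almost everywhere means everywhere on the support. A finite double
    integral thus makes every inner integral over the support finite, so the inner Bochner integrals
    are genuine values and not the default 0.\<close>
  have ae: "AE x in M. (\<integral>\<^sup>+y. ennreal (g y) \<partial>N x) \<noteq> \<infinity>"
    using fin by (intro nn_integral_PInf_AE) auto
  have inner: "(\<integral>\<^sup>+y. ennreal (g y) \<partial>N x) = ennreal (measure_pmf.expectation (N x) g)"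
    if "x \<in> set_pmf M" for x
  proof -
    have "(\<integral>\<^sup>+y. ennreal (g y) \<partial>N x) < \<infinity>"
      using ae that by (auto simp: AE_measure_pmf_iff top.not_eq_extremum)
    hence "integrable (N x) g"
      using nonneg that by (intro integrableI_nonneg) (auto simp: AE_measure_pmf_iff)
    thus ?thesis
      using nonneg that by (intro nn_integral_eq_integral) (auto simp: AE_measure_pmf_iff)
  qed
  have nn: "AE x in M. 0 \<le> measure_pmf.expectation (N x) g"
    using nonneg by (auto simp: AE_measure_pmf_iff intro!: integral_nonneg_AE)
  have eq: "(\<integral>\<^sup>+x. \<integral>\<^sup>+y. ennreal (g y) \<partial>N x \<partial>M)
      = (\<integral>\<^sup>+x. ennreal (measure_pmf.expectation (N x) g) \<partial>M)"
    by (intro nn_integral_cong_AE) (auto simp: AE_measure_pmf_iff inner)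
  show integrable: ?int
    using fin nn unfolding eq by (intro integrableI_nonneg) auto
  have "ennreal (measure_pmf.expectation (bind_pmf M N) g)
      = ennreal (measure_pmf.expectation M (\<lambda>x. measure_pmf.expectation (N x) g))"
    using int nonneg nn integrable
    by (subst (1 2) nn_integral_eq_integral[symmetric])
       (auto simp: AE_measure_pmf_iff eq)
  thus ?eq
    using nonneg nn by (subst (asm) ennreal_inj)
      (auto simp: AE_measure_pmf_iff intro!: integral_nonneg_AE)
qed

lemma integrable_bind_imp_integrable:
  fixes g :: "'b \<Rightarrow> real"
  assumes "integrable (measure_pmf (bind_pmf M N)) g" "x \<in> set_pmf M"
  shows "integrable (measure_pmf (N x)) g"
proof -
  have "(\<integral>\<^sup>+x. \<integral>\<^sup>+y. ennreal (norm (g y)) \<partial>N x \<partial>M) < \<infinity>"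
    using assms(1) by (simp add: integrable_iff_bounded)
  hence "AE x in M. (\<integral>\<^sup>+y. ennreal (norm (g y)) \<partial>N x) \<noteq> \<infinity>"
    by (intro nn_integral_PInf_AE) auto
  thus ?thesis
    using assms(2) by (auto simp: AE_measure_pmf_iff integrable_iff_bounded top.not_eq_extremum)
qed

lemma expectation_mono_pmf:
  fixes f g :: "'a \<Rightarrow> real"
  assumes "integrable (measure_pmf M) f" "integrable (measure_pmf M) g"
    and "\<And>x. x \<in> set_pmf M \<Longrightarrow> f x \<le> g x"
  shows "measure_pmf.expectation M f \<le> measure_pmf.expectation M g"
  using assms by (intro integral_mono_AE) (auto simp: AE_measure_pmf_iff)

lemma expectation_cong_pmf:
  fixes f g :: "'a \<Rightarrow> real"
  assumes "\<And>x. x \<in> set_pmf M \<Longrightarrow> f x = g x"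
  shows "measure_pmf.expectation M f = measure_pmf.expectation M g"
  using assms by (intro integral_cong_AE) (auto simp: AE_measure_pmf_iff)

lemma expectation_nonneg_pmf:
  fixes f :: "'a \<Rightarrow> real"
  assumes "\<And>x. x \<in> set_pmf M \<Longrightarrow> 0 \<le> f x"
  shows "0 \<le> measure_pmf.expectation M f"
  using assms by (intro integral_nonneg_AE) (auto simp: AE_measure_pmf_iff)

lemma integrable_bound_pmf:
  fixes f g :: "'a \<Rightarrow> real"
  assumes "integrable (measure_pmf M) g" "\<And>x. x \<in> set_pmf M \<Longrightarrow> \<bar>f x\<bar> \<le> g x"
  shows "integrable (measure_pmf M) f"
  by (rule Bochner_Integration.integrable_bound[OF assms(1)])
     (use assms(2) in \<open>fastforce simp: AE_measure_pmf_iff\<close>)+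

section \<open>Posteriors and the Bellman recursion for policy values\<close>

locale adaptive_utility =
  fixes E :: "'e set" and Os :: "'o set" and p :: "('e \<Rightarrow> 'o) pmf"
    and f :: "'e set \<Rightarrow> ('e \<Rightarrow> 'o) \<Rightarrow> real"
  assumes finite_E: "finite E"
    and prior: "set_pmf p \<subseteq> (E \<rightarrow>\<^sub>E Os)"
    and f_nonneg: "\<And>S \<phi>. S \<subseteq> E \<Longrightarrow> \<phi> \<in> E \<rightarrow>\<^sub>E Os \<Longrightarrow> 0 \<le> f S \<phi>"
    and f_integrable: "\<And>S. S \<subseteq> E \<Longrightarrow> integrable (measure_pmf p) (f S)"
    and submodular: "fully_adaptive_submodular E Os p f"
    and monotone: "adaptive_monotone E p f"
begin

abbreviation "PR \<equiv> partial_realizations E p"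

definition posterior :: "('e \<rightharpoonup> 'o) \<Rightarrow> ('e \<Rightarrow> 'o) pmf" where
  "posterior \<psi> = cond_pmf p {\<phi>. agrees \<phi> \<psi>}"

definition observe :: "'e \<Rightarrow> ('e \<rightharpoonup> 'o) \<Rightarrow> 'o pmf" where
  "observe e \<psi> = map_pmf (\<lambda>\<phi>. \<phi> e) (posterior \<psi>)"

text \<open>One function that dominates \<open>f S\<close> for all \<open>S \<subseteq> E\<close> at
  once, hence the utility of every policy. A sum instead of a maximum makes its integrability
  immediate.\<close>

definition envelope :: "('e \<Rightarrow> 'o) \<Rightarrow> real" where
  "envelope \<phi> = (\<Sum>S\<in>Pow E. f S \<phi>)"

definition bound :: "('e \<rightharpoonup> 'o) \<Rightarrow> real" where
  "bound \<psi> = measure_pmf.expectation (posterior \<psi>) envelope"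

text \<open>A joint law of realization and selected set, because it can be split in two ways: along
  the realization, as in \<open>f_avg\<close>, and along the first node of the tree, as in the
  Bellman recursion.\<close>

definition run :: "('e, 'o) policy \<Rightarrow> ('e \<rightharpoonup> 'o) \<Rightarrow> (('e \<Rightarrow> 'o) \<times> 'e set) pmf" where
  "run \<pi> \<psi> = bind_pmf (posterior \<psi>) (\<lambda>\<phi>. map_pmf (Pair \<phi>) (selected \<pi> \<phi>))"

definition util :: "('e \<rightharpoonup> 'o) \<Rightarrow> ('e \<Rightarrow> 'o) \<times> 'e set \<Rightarrow> real" where
  "util \<psi> = (\<lambda>(\<phi>, S). f ((dom \<psi> \<union> S) \<inter> E) \<phi>)"

text \<open>Only the selected items in \<open>E\<close> count, so that integrability holds for every policy.\<close>
definition val :: "('e, 'o) policy \<Rightarrow> ('e \<rightharpoonup> 'o) \<Rightarrow> real" where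
  "val \<pi> \<psi> = measure_pmf.expectation (run \<pi> \<psi>) (util \<psi>)"

lemma PR_iff: "\<psi> \<in> PR \<longleftrightarrow> dom \<psi> \<subseteq> E \<and> set_pmf p \<inter> {\<phi>. agrees \<phi> \<psi>} \<noteq> {}"
  unfolding partial_realizations_def
  by (auto simp: measure_pmf_zero_iff zero_less_measure_iff)

lemma set_posterior: "\<psi> \<in> PR \<Longrightarrow> set_pmf (posterior \<psi>) = set_pmf p \<inter> {\<phi>. agrees \<phi> \<psi>}"
  unfolding posterior_def PR_iff by (intro set_cond_pmf) auto

lemma empty_PR: "Map.empty \<in> PR"
  using set_pmf_not_empty[of p] by (auto simp: PR_iff agrees_def)

lemma posterior_empty: "posterior Map.empty = p"
proof -
  have "set_pmf p \<inter> UNIV \<noteq> {}"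
    using set_pmf_not_empty[of p] by auto
  thus ?thesis
    by (intro pmf_eqI) (simp add: posterior_def agrees_def pmf_cond)
qed

lemma agrees_updI: "agrees \<phi> \<psi> \<Longrightarrow> agrees \<phi> (\<psi>(e \<mapsto> \<phi> e))"
  by (auto simp: agrees_def)

lemma set_observe: "\<psi> \<in> PR \<Longrightarrow> set_pmf (observe e \<psi>) = {\<phi> e |\<phi>. \<phi> \<in> set_pmf p \<and> agrees \<phi> \<psi>}"
  by (auto simp: observe_def set_posterior)

lemma upd_PR: "\<psi> \<in> PR \<Longrightarrow> e \<in> E \<Longrightarrow> s \<in> set_pmf (observe e \<psi>) \<Longrightarrow> \<psi>(e \<mapsto> s) \<in> PR"
  using agrees_updI[of _ \<psi> e] by (fastforce simp: set_observe PR_iff)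

text \<open>All realizations that agree with \<open>\<psi>\<close> give an observed item the same
  state. Policies may select an item again, and this makes the repetition a void step.\<close>

lemma upd_dom: "\<psi> \<in> PR \<Longrightarrow> e \<in> dom \<psi> \<Longrightarrow> s \<in> set_pmf (observe e \<psi>) \<Longrightarrow> \<psi>(e \<mapsto> s) = \<psi>"
  by (intro map_upd_triv) (auto simp: set_observe agrees_def)

lemma upd_extends:
  assumes "\<psi> \<in> PR" "s \<in> set_pmf (observe e \<psi>)"
  shows "\<psi> \<subseteq>\<^sub>m \<psi>(e \<mapsto> s)"
  using upd_dom[OF assms(1) _ assms(2)] by (cases "e \<in> dom \<psi>") (auto simp: map_le_def)

lemma posterior_upd:
  assumes "\<psi> \<in> PR" "e \<in> E" "s \<in> set_pmf (observe e \<psi>)"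
  shows "posterior (\<psi>(e \<mapsto> s)) = cond_pmf (posterior \<psi>) {\<phi>. \<phi> e = s}"
proof -
  have ne: "set_pmf p \<inter> {\<phi>. agrees \<phi> \<psi>} \<noteq> {}" "set_pmf p \<inter> {\<phi>. agrees \<phi> (\<psi>(e \<mapsto> s))} \<noteq> {}"
      "set_pmf (posterior \<psi>) \<inter> {\<phi>. \<phi> e = s} \<noteq> {}"
    using assms upd_PR[OF assms] by (auto simp: PR_iff observe_def)
  have ag: "agrees \<phi> (\<psi>(e \<mapsto> s)) \<longleftrightarrow> agrees \<phi> \<psi> \<and> \<phi> e = s" for \<phi>
  proof (cases "e \<in> dom \<psi>")
    case True
    hence "\<psi> e = Some s"
      using upd_dom[OF assms(1) _ assms(3)] by (metis fun_upd_same)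
    thus ?thesis
      by (auto simp: agrees_def dom_def split: if_splits)
  qed (auto simp: agrees_def dom_def split: if_splits)
  have m: "measure_pmf.prob (posterior \<psi>) {\<phi>. \<phi> e = s}
     = measure_pmf.prob p {\<phi>. agrees \<phi> \<psi> \<and> \<phi> e = s} / measure_pmf.prob p {\<phi>. agrees \<phi> \<psi>}"
    unfolding posterior_def cond_pmf.rep_eq[OF ne(1)] using ne(1)
    by (subst measure_uniform_measure)
       (auto simp: Int_def emeasure_measure_pmf_not_zero)
  show ?thesis
    by (rule pmf_eqI)
       (use ne measure_measure_pmf_not_zero[OF ne(1)] in \<open>auto simp: pmf_cond m[unfolded posterior_def] ag posterior_def\<close>)
qed


text \<open>The tower property: one observation splits the posterior into the posteriors of the
  extended partial realizations.\<close>

lemma bind_observe_posterior: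
  assumes "\<psi> \<in> PR" "e \<in> E"
  shows "bind_pmf (observe e \<psi>) (\<lambda>s. posterior (\<psi>(e \<mapsto> s))) = posterior \<psi>"
proof -
  have "bind_pmf (observe e \<psi>) (\<lambda>s. posterior (\<psi>(e \<mapsto> s)))
      = bind_pmf (observe e \<psi>) (\<lambda>s. cond_pmf (posterior \<psi>) {\<phi>. \<phi> e = s})"
    using assms by (intro bind_pmf_cong) (auto simp: posterior_upd)
  also have "\<dots> = posterior \<psi>"
  proof (intro bind_cond_pmf_cancel)
    show "measure_pmf.prob (posterior \<psi>) {\<phi>. \<phi> e = s} = measure_pmf.prob (observe e \<psi>) {t. \<phi> e = t}"
      if "\<phi> e = s" for \<phi> s
      using that by (simp add: observe_def vimage_def eq_commute)
  qed (auto simp: observe_def)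
  finally show ?thesis .
qed

text \<open>After the observation of \<open>s\<close>, all realizations in the support have state
  \<open>s\<close> at \<open>e\<close>, so the branch taken no longer depends on the
  realization.\<close>

lemma run_Select:
  assumes "\<psi> \<in> PR" "e \<in> E"
  shows "run (Select e k) \<psi> =
    bind_pmf (observe e \<psi>) (\<lambda>s. map_pmf (apsnd (insert e)) (run (k s) (\<psi>(e \<mapsto> s))))"
proof -
  have "run (Select e k) \<psi> = bind_pmf (observe e \<psi>) (\<lambda>s. bind_pmf (posterior (\<psi>(e \<mapsto> s)))
      (\<lambda>\<phi>. map_pmf (Pair \<phi>) (map_pmf (insert e) (selected (k (\<phi> e)) \<phi>))))"
    by (simp add: run_def bind_observe_posterior[OF assms, symmetric] bind_assoc_pmf)
  also have "\<dots> = bind_pmf (observe e \<psi>) (\<lambda>s. bind_pmf (posterior (\<psi>(e \<mapsto> s)))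
      (\<lambda>\<phi>. map_pmf (Pair \<phi>) (map_pmf (insert e) (selected (k s) \<phi>))))"
    using assms by (intro bind_pmf_cong refl)
      (auto simp: set_posterior upd_PR agrees_def)
  also have "\<dots> = bind_pmf (observe e \<psi>) (\<lambda>s. map_pmf (apsnd (insert e)) (run (k s) (\<psi>(e \<mapsto> s))))"
    by (simp add: run_def map_bind_pmf pmf.map_comp o_def)
  finally show ?thesis .
qed

text \<open>The coin is independent of the realization, so the two draws commute.\<close>

lemma run_Toss: "run (Toss D) \<psi> = bind_pmf D (\<lambda>\<pi>. run \<pi> \<psi>)"
  unfolding run_def
  by (subst bind_commute_pmf) (simp add: join_pmf_def bind_map_pmf map_bind_pmf)

lemma set_run:
  "\<psi> \<in> PR \<Longrightarrow> set_pmf (run \<pi> \<psi>) =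
    {(\<phi>, S). \<phi> \<in> set_pmf p \<and> agrees \<phi> \<psi> \<and> S \<in> set_pmf (selected \<pi> \<phi>)}"
  by (auto simp: run_def set_posterior)

lemma envelope_ge: "\<phi> \<in> set_pmf p \<Longrightarrow> S \<subseteq> E \<Longrightarrow> f S \<phi> \<le> envelope \<phi>"
  unfolding envelope_def using finite_E prior f_nonneg
  by (intro member_le_sum) auto

lemma envelope_nonneg: "\<phi> \<in> set_pmf p \<Longrightarrow> 0 \<le> envelope \<phi>"
  unfolding envelope_def using prior f_nonneg by (intro sum_nonneg) auto

lemma integrable_posterior:
  fixes g :: "('e \<Rightarrow> 'o) \<Rightarrow> real"
  assumes "\<psi> \<in> PR" "integrable (measure_pmf p) g"
  shows "integrable (measure_pmf (posterior \<psi>)) g"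
proof -
  have "set_pmf p \<inter> {\<phi>. agrees \<phi> \<psi>} \<noteq> {}"
    using assms by (simp add: PR_iff)
  note ne = this
  have "(\<integral>\<^sup>+x. ennreal (norm (g x)) * indicator {\<phi>. agrees \<phi> \<psi>} x \<partial>p) \<le> (\<integral>\<^sup>+x. ennreal (norm (g x)) \<partial>p)"
    by (intro nn_integral_mono) (auto simp: indicator_def)
  also have "\<dots> < \<infinity>"
    using assms(2) by (simp add: integrable_iff_bounded)
  finally have "(\<integral>\<^sup>+x. ennreal (norm (g x)) \<partial>posterior \<psi>) < \<infinity>"
    unfolding posterior_def cond_pmf.rep_eq[OF ne]
    using emeasure_measure_pmf_not_zero[OF ne]
    by (subst nn_integral_uniform_measure) (auto simp: ennreal_divide_eq_top_iff less_top[symmetric])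
  thus ?thesis
    by (simp add: integrable_iff_bounded)
qed

lemma envelope_integrable: "integrable (measure_pmf p) envelope"
  unfolding envelope_def by (intro Bochner_Integration.integrable_sum f_integrable) auto

lemma integrable_run_envelope:
  assumes "\<psi> \<in> PR"
  shows "integrable (measure_pmf (run \<pi> \<psi>)) (\<lambda>x. envelope (fst x))"
proof -
  have "map_pmf fst (run \<pi> \<psi>) = posterior \<psi>"
    by (simp add: run_def map_bind_pmf pmf.map_comp o_def map_pmf_const bind_return_pmf')
  thus ?thesis
    using integrable_posterior[OF assms envelope_integrable]
    by (metis integrable_map_pmf_eq)
qed

lemma util_nonneg: "\<psi> \<in> PR \<Longrightarrow> x \<in> set_pmf (run \<pi> \<psi>) \<Longrightarrow> 0 \<le> util \<psi> x"
  using prior by (auto simp: set_run util_def intro!: f_nonneg)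

lemma util_le: "\<psi> \<in> PR \<Longrightarrow> x \<in> set_pmf (run \<pi> \<psi>) \<Longrightarrow> util \<psi> x \<le> envelope (fst x)"
  by (auto simp: set_run util_def intro!: envelope_ge)

lemma integrable_util: "\<psi> \<in> PR \<Longrightarrow> integrable (measure_pmf (run \<pi> \<psi>)) (util \<psi>)"
  using util_nonneg util_le
  by (intro integrable_bound_pmf[OF integrable_run_envelope]) (auto simp: abs_of_nonneg)

lemma val_nonneg: "\<psi> \<in> PR \<Longrightarrow> 0 \<le> val \<pi> \<psi>"
  unfolding val_def using util_nonneg by (intro expectation_nonneg_pmf)

lemma val_le_bound:
  assumes "\<psi> \<in> PR"
  shows "val \<pi> \<psi> \<le> bound \<psi>"
proof -
  have "map_pmf fst (run \<pi> \<psi>) = posterior \<psi>"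
    by (simp add: run_def map_bind_pmf pmf.map_comp o_def map_pmf_const bind_return_pmf')
  hence "bound \<psi> = measure_pmf.expectation (run \<pi> \<psi>) (\<lambda>x. envelope (fst x))"
    unfolding bound_def by (metis integral_map_pmf)
  thus ?thesis
    unfolding val_def using assms util_le
    by (auto intro!: expectation_mono_pmf integrable_util integrable_run_envelope)
qed

lemma bound_nonneg: "\<psi> \<in> PR \<Longrightarrow> 0 \<le> bound \<psi>"
  using val_le_bound[of \<psi> Stop] val_nonneg[of \<psi> Stop] by linarith

lemma val_Stop: "\<psi> \<in> PR \<Longrightarrow> val Stop \<psi> = measure_pmf.expectation (posterior \<psi>) (f (dom \<psi>))"
  by (simp add: val_def run_def util_def map_pmf_def[symmetric] PR_iff Int_absorb2)

lemma util_upd: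
  "\<psi> \<in> PR \<Longrightarrow> e \<in> E \<Longrightarrow> util \<psi> (apsnd (insert e) x) = util (\<psi>(e \<mapsto> s)) x"
  by (auto simp: util_def PR_iff split: prod.splits intro!: arg_cong2[where f=f])

lemma val_Select:
  assumes "\<psi> \<in> PR" "e \<in> E"
  shows "val (Select e k) \<psi> = measure_pmf.expectation (observe e \<psi>) (\<lambda>s. val (k s) (\<psi>(e \<mapsto> s)))"
proof -
  have "val (Select e k) \<psi> = measure_pmf.expectation (observe e \<psi>)
      (\<lambda>s. measure_pmf.expectation (map_pmf (apsnd (insert e)) (run (k s) (\<psi>(e \<mapsto> s)))) (util \<psi>))"
    unfolding val_def run_Select[OF assms]
    using assms by (intro expectation_bind_nonneg)
      (auto simp: run_Select[OF assms, symmetric] intro: integrable_util intro!: util_nonneg)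
  also have "\<dots> = measure_pmf.expectation (observe e \<psi>) (\<lambda>s. val (k s) (\<psi>(e \<mapsto> s)))"
    unfolding val_def integral_map_pmf by (intro expectation_cong_pmf util_upd[OF assms])
  finally show ?thesis .
qed

lemma
  assumes "\<psi> \<in> PR"
  shows val_Toss: "val (Toss D) \<psi> = measure_pmf.expectation D (\<lambda>\<pi>. val \<pi> \<psi>)"
    and integrable_val_Toss: "integrable (measure_pmf D) (\<lambda>\<pi>. val \<pi> \<psi>)"
proof -
  have "integrable (measure_pmf (bind_pmf D (\<lambda>\<pi>. run \<pi> \<psi>))) (util \<psi>)"
    and "\<And>x. x \<in> set_pmf (bind_pmf D (\<lambda>\<pi>. run \<pi> \<psi>)) \<Longrightarrow> 0 \<le> util \<psi> x"
    using assms integrable_util[OF assms, of "Toss D"] util_nonneg[OF assms, of _ "Toss D"]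
    unfolding run_Toss by blast+
  from expectation_bind_nonneg[OF this(2,1)] integrable_expectation_bind_nonneg[OF this(2,1)]
  show "val (Toss D) \<psi> = measure_pmf.expectation D (\<lambda>\<pi>. val \<pi> \<psi>)"
    and "integrable (measure_pmf D) (\<lambda>\<pi>. val \<pi> \<psi>)"
    unfolding val_def run_Toss by blast+
qed

section \<open>Averaging over one observation\<close>

text \<open>Mixing the posteriors after an observation gives back the posterior before it, under
  which the envelope is integrable. This is what qualifies \<open>bound\<close> as the common
  dominating function.\<close>

lemma integrable_bound_upd:
  assumes "\<psi> \<in> PR" "e \<in> E"
  shows "integrable (measure_pmf (observe e \<psi>)) (\<lambda>s. bound (\<psi>(e \<mapsto> s)))"
proof -
  have "integrable (measure_pmf (bind_pmf (observe e \<psi>) (\<lambda>s. posterior (\<psi>(e \<mapsto> s))))) envelope"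
    and "\<And>\<phi>. \<phi> \<in> set_pmf (bind_pmf (observe e \<psi>) (\<lambda>s. posterior (\<psi>(e \<mapsto> s)))) \<Longrightarrow> 0 \<le> envelope \<phi>"
    unfolding bind_observe_posterior[OF assms]
    using integrable_posterior[OF assms(1) envelope_integrable] envelope_nonneg
    by (auto simp: set_posterior[OF assms(1)])
  from integrable_expectation_bind_nonneg[OF this(2,1)] show ?thesis
    unfolding bound_def .
qed

text \<open>Functions of the partial realization that are integrable after any further observation.\<close>
definition controlled :: "(('e \<rightharpoonup> 'o) \<Rightarrow> real) \<Rightarrow> bool" where
  "controlled u \<longleftrightarrow> (\<exists>c. \<forall>\<psi>\<in>PR. \<bar>u \<psi>\<bar> \<le> c * bound \<psi>)"

lemma controlledI: "(\<And>\<psi>. \<psi> \<in> PR \<Longrightarrow> \<bar>u \<psi>\<bar> \<le> c * bound \<psi>) \<Longrightarrow> controlled u"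
  unfolding controlled_def by auto

lemma controlled_add:
  assumes "controlled u" "controlled w"
  shows "controlled (\<lambda>\<psi>. u \<psi> + w \<psi>)"
proof -
  obtain c c' where c: "\<And>\<psi>. \<psi> \<in> PR \<Longrightarrow> \<bar>u \<psi>\<bar> \<le> c * bound \<psi>" "\<And>\<psi>. \<psi> \<in> PR \<Longrightarrow> \<bar>w \<psi>\<bar> \<le> c' * bound \<psi>"
    using assms unfolding controlled_def by blast
  have "\<bar>u \<psi> + w \<psi>\<bar> \<le> (c + c') * bound \<psi>" if "\<psi> \<in> PR" for \<psi>
    using c[OF that] by (simp add: algebra_simps)
  thus ?thesis
    by (rule controlledI)
qed

lemma controlled_cmult:
  assumes "controlled u"
  shows "controlled (\<lambda>\<psi>. a * u \<psi>)"
proof -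
  obtain c where c: "\<And>\<psi>. \<psi> \<in> PR \<Longrightarrow> \<bar>u \<psi>\<bar> \<le> c * bound \<psi>"
    using assms unfolding controlled_def by blast
  have "\<bar>a * u \<psi>\<bar> \<le> (\<bar>a\<bar> * c) * bound \<psi>" if "\<psi> \<in> PR" for \<psi>
    using c[OF that] by (simp add: abs_mult mult.assoc mult_left_mono)
  thus ?thesis
    by (rule controlledI)
qed

lemma controlled_diff: "controlled u \<Longrightarrow> controlled w \<Longrightarrow> controlled (\<lambda>\<psi>. u \<psi> - w \<psi>)"
  using controlled_add[OF _ controlled_cmult[of w "-1"], of u] by simp

lemma controlled_sum: "(\<And>i. i \<in> I \<Longrightarrow> controlled (u i)) \<Longrightarrow> controlled (\<lambda>\<psi>. \<Sum>i\<in>I. u i \<psi>)"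
proof (induction I rule: infinite_finite_induct)
  case (insert i I)
  have "controlled (\<lambda>\<psi>. u i \<psi> + (\<Sum>i\<in>I. u i \<psi>))"
    using insert by (intro controlled_add) auto
  thus ?case
    using insert by simp
qed (simp_all add: controlled_def exI[of _ 0])

lemma controlled_val: "controlled (val \<pi>)"
  by (rule controlledI[where c=1]) (simp add: val_nonneg val_le_bound)

lemma integrable_controlled:
  assumes "controlled u" "\<psi> \<in> PR" "e \<in> E"
  shows "integrable (measure_pmf (observe e \<psi>)) (\<lambda>s. u (\<psi>(e \<mapsto> s)))"
proof -
  obtain c where "\<And>\<psi>. \<psi> \<in> PR \<Longrightarrow> \<bar>u \<psi>\<bar> \<le> c * bound \<psi>"
    using assms(1) unfolding controlled_def by blast
  hence "\<bar>u (\<psi>(e \<mapsto> s))\<bar> \<le> c * bound (\<psi>(e \<mapsto> s))" if "s \<in> set_pmf (observe e \<psi>)" for s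
    using upd_PR[OF assms(2,3) that] by blast
  moreover have "integrable (measure_pmf (observe e \<psi>)) (\<lambda>s. c * bound (\<psi>(e \<mapsto> s)))"
    using integrable_bound_upd[OF assms(2,3)] by simp
  ultimately show ?thesis
    by (rule integrable_bound_pmf[rotated])
qed

lemma integrable_val_cont:
  assumes "\<psi> \<in> PR" "e \<in> E"
  shows "integrable (measure_pmf (observe e \<psi>)) (\<lambda>s. val (k s) (\<psi>(e \<mapsto> s)))"
proof (rule integrable_bound_pmf[OF integrable_bound_upd[OF assms]])
  fix s assume "s \<in> set_pmf (observe e \<psi>)"
  with assms have "\<psi>(e \<mapsto> s) \<in> PR"
    by (rule upd_PR)
  thus "\<bar>val (k s) (\<psi>(e \<mapsto> s))\<bar> \<le> bound (\<psi>(e \<mapsto> s))"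
    by (simp add: val_nonneg val_le_bound)
qed


definition after :: "'e \<Rightarrow> (('e \<rightharpoonup> 'o) \<Rightarrow> real) \<Rightarrow> ('e \<rightharpoonup> 'o) \<Rightarrow> real" where
  "after e u \<psi> = measure_pmf.expectation (observe e \<psi>) (\<lambda>s. u (\<psi>(e \<mapsto> s)))"

lemma after_val: "\<psi> \<in> PR \<Longrightarrow> e \<in> E \<Longrightarrow> after e (val \<pi>) \<psi> = val (Select e (\<lambda>_. \<pi>)) \<psi>"
  by (simp add: after_def val_Select)

lemma after_mono:
  assumes "controlled u" "controlled w" "\<psi> \<in> PR" "e \<in> E"
    and "\<And>s. s \<in> set_pmf (observe e \<psi>) \<Longrightarrow> u (\<psi>(e \<mapsto> s)) \<le> w (\<psi>(e \<mapsto> s))"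
  shows "after e u \<psi> \<le> after e w \<psi>"
  unfolding after_def by (intro expectation_mono_pmf integrable_controlled assms)

lemma after_add:
  assumes "controlled u" "controlled w" "\<psi> \<in> PR" "e \<in> E"
  shows "after e (\<lambda>\<psi>. u \<psi> + w \<psi>) \<psi> = after e u \<psi> + after e w \<psi>"
  unfolding after_def by (intro Bochner_Integration.integral_add integrable_controlled assms)

lemma after_diff:
  assumes "controlled u" "controlled w" "\<psi> \<in> PR" "e \<in> E"
  shows "after e (\<lambda>\<psi>. u \<psi> - w \<psi>) \<psi> = after e u \<psi> - after e w \<psi>"
  unfolding after_def by (intro Bochner_Integration.integral_diff integrable_controlled assms)

lemma after_cmult: "after e (\<lambda>\<psi>. c * u \<psi>) \<psi> = c * after e u \<psi>"
  unfolding after_def by simp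

lemma after_sum:
  assumes "\<And>i. i \<in> I \<Longrightarrow> controlled (u i)" "\<psi> \<in> PR" "e \<in> E"
  shows "after e (\<lambda>\<psi>. \<Sum>i\<in>I. u i \<psi>) \<psi> = (\<Sum>i\<in>I. after e (u i) \<psi>)"
  unfolding after_def by (intro Bochner_Integration.integral_sum integrable_controlled assms)

lemma after_const [simp]: "after e (\<lambda>_. c) \<psi> = c"
  unfolding after_def by simp

lemma after_dom:
  assumes "\<psi> \<in> PR" "e \<in> dom \<psi>"
  shows "after e u \<psi> = u \<psi>"
proof -
  have "after e u \<psi> = measure_pmf.expectation (observe e \<psi>) (\<lambda>_. u \<psi>)"
    unfolding after_def using upd_dom[OF assms] by (intro expectation_cong_pmf) simp
  thus ?thesis by simp
qed

lemma after_le: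
  assumes "controlled u" "\<psi> \<in> PR" "e \<in> E"
    and "\<And>s. s \<in> set_pmf (observe e \<psi>) \<Longrightarrow> u (\<psi>(e \<mapsto> s)) \<le> c"
  shows "after e u \<psi> \<le> c"
proof -
  have "after e u \<psi> \<le> measure_pmf.expectation (observe e \<psi>) (\<lambda>_. c)"
    unfolding after_def
    by (rule expectation_mono_pmf[OF integrable_controlled[OF assms(1-3)] _ assms(4)]) auto
  thus ?thesis by simp
qed

section \<open>Gains of policies and items, and monotonicity\<close>

text \<open>A tree matters only through the law of the set that it selects, so selections may be
  reordered inside it.\<close>

lemma val_cong: "(\<And>\<phi>. selected \<pi> \<phi> = selected \<pi>' \<phi>) \<Longrightarrow> val \<pi> \<psi> = val \<pi>' \<psi>"
  by (simp add: val_def run_def)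

lemma val_nested:
  assumes "\<psi> \<in> PR"
  shows "val \<pi> \<psi> = measure_pmf.expectation (posterior \<psi>)
      (\<lambda>\<phi>. measure_pmf.expectation (selected \<pi> \<phi>) (\<lambda>S. f ((dom \<psi> \<union> S) \<inter> E) \<phi>))" (is "_ = ?r")
    and "integrable (measure_pmf (posterior \<psi>))
      (\<lambda>\<phi>. measure_pmf.expectation (selected \<pi> \<phi>) (\<lambda>S. f ((dom \<psi> \<union> S) \<inter> E) \<phi>))"
proof -
  have "integrable (measure_pmf (run \<pi> \<psi>)) (util \<psi>)"
    and "\<And>x. x \<in> set_pmf (run \<pi> \<psi>) \<Longrightarrow> 0 \<le> util \<psi> x"
    using assms integrable_util util_nonneg by blast+
  note * = this[unfolded run_def]
  from expectation_bind_nonneg[OF *(2,1)] integrable_expectation_bind_nonneg[OF *(2,1)]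
  show "val \<pi> \<psi> = ?r" and "integrable (measure_pmf (posterior \<psi>))
      (\<lambda>\<phi>. measure_pmf.expectation (selected \<pi> \<phi>) (\<lambda>S. f ((dom \<psi> \<union> S) \<inter> E) \<phi>))"
    unfolding val_def run_def util_def by simp_all
qed

lemma integrable_selected:
  assumes "\<psi> \<in> PR" "\<phi> \<in> set_pmf (posterior \<psi>)"
  shows "integrable (measure_pmf (selected \<pi> \<phi>)) (\<lambda>S. f ((dom \<psi> \<union> S) \<inter> E) \<phi>)"
proof -
  have "integrable (measure_pmf (map_pmf (Pair \<phi>) (selected \<pi> \<phi>))) (util \<psi>)"
    using integrable_util[OF assms(1)] assms(2) unfolding run_def
    by (rule integrable_bind_imp_integrable)
  thus ?thesis
    by (simp add: util_def)
qed

lemma policy_gain_eq: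
  assumes \<psi>: "\<psi> \<in> PR"
    and sel: "\<And>\<phi> S. \<phi> \<in> set_pmf p \<Longrightarrow> S \<in> set_pmf (selected \<pi> \<phi>) \<Longrightarrow> S \<subseteq> E"
  shows "policy_gain p f \<pi> \<psi> = val \<pi> \<psi> - val Stop \<psi>"
proof -
  have dom: "dom \<psi> \<subseteq> E"
    using \<psi> by (simp add: PR_iff)
  have int: "integrable (measure_pmf (posterior \<psi>)) (f (dom \<psi>))"
    using integrable_posterior[OF \<psi> f_integrable[OF dom]] .
  have inner: "measure_pmf.expectation (selected \<pi> \<phi>) (\<lambda>S. f (dom \<psi> \<union> S) \<phi> - f (dom \<psi>) \<phi>)
     = measure_pmf.expectation (selected \<pi> \<phi>) (\<lambda>S. f ((dom \<psi> \<union> S) \<inter> E) \<phi>) - f (dom \<psi>) \<phi>"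
    if "\<phi> \<in> set_pmf (posterior \<psi>)" for \<phi>
  proof -
    have "measure_pmf.expectation (selected \<pi> \<phi>) (\<lambda>S. f (dom \<psi> \<union> S) \<phi> - f (dom \<psi>) \<phi>)
        = measure_pmf.expectation (selected \<pi> \<phi>) (\<lambda>S. f ((dom \<psi> \<union> S) \<inter> E) \<phi> - f (dom \<psi>) \<phi>)"
    proof (rule expectation_cong_pmf)
      fix S assume "S \<in> set_pmf (selected \<pi> \<phi>)"
      hence "(dom \<psi> \<union> S) \<inter> E = dom \<psi> \<union> S"
        using sel[of \<phi> S] that dom by (auto simp: set_posterior[OF \<psi>])
      thus "f (dom \<psi> \<union> S) \<phi> - f (dom \<psi>) \<phi> = f ((dom \<psi> \<union> S) \<inter> E) \<phi> - f (dom \<psi>) \<phi>" by simp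
    qed
    also have "\<dots> = measure_pmf.expectation (selected \<pi> \<phi>) (\<lambda>S. f ((dom \<psi> \<union> S) \<inter> E) \<phi>) - f (dom \<psi>) \<phi>"
      using integrable_selected[OF \<psi> that] by (subst Bochner_Integration.integral_diff) auto
    finally show ?thesis .
  qed
  have "policy_gain p f \<pi> \<psi> = measure_pmf.expectation (posterior \<psi>)
     (\<lambda>\<phi>. measure_pmf.expectation (selected \<pi> \<phi>) (\<lambda>S. f ((dom \<psi> \<union> S) \<inter> E) \<phi>) - f (dom \<psi>) \<phi>)"
    unfolding policy_gain_def posterior_def[symmetric] using inner by (intro expectation_cong_pmf)
  also have "\<dots> = val \<pi> \<psi> - val Stop \<psi>"
    unfolding val_nested(1)[OF \<psi>, of \<pi>] val_Stop[OF \<psi>]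
    by (intro Bochner_Integration.integral_diff int val_nested(2)[OF \<psi>])
  finally show ?thesis .
qed

lemma f_avg_eq_val:
  assumes "\<And>\<phi> S. \<phi> \<in> set_pmf p \<Longrightarrow> S \<in> set_pmf (selected \<pi> \<phi>) \<Longrightarrow> S \<subseteq> E"
  shows "f_avg p f \<pi> = val \<pi> Map.empty"
  unfolding f_avg_def val_nested(1)[OF empty_PR] posterior_empty using assms
  by (intro expectation_cong_pmf) (simp add: Int_absorb2)

lemma item_gain_eq:
  assumes "\<psi> \<in> PR" "e \<in> E"
  shows "item_gain p f e \<psi> = after e (val Stop) \<psi> - val Stop \<psi>"
proof -
  have "item_gain p f e \<psi> = policy_gain p f (Select e (\<lambda>_. Stop)) \<psi>"
    by (simp add: item_gain_def policy_gain_def)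
  also have "\<dots> = after e (val Stop) \<psi> - val Stop \<psi>"
    using assms by (subst policy_gain_eq) (auto simp: after_val)
  finally show ?thesis .
qed

lemma item_gain_nonneg: "\<psi> \<in> PR \<Longrightarrow> e \<in> E \<Longrightarrow> 0 \<le> item_gain p f e \<psi>"
  using monotone unfolding adaptive_monotone_def by blast

lemma item_gain_dom: "\<psi> \<in> PR \<Longrightarrow> e \<in> dom \<psi> \<Longrightarrow> item_gain p f e \<psi> = 0"
  by (subst item_gain_eq) (auto simp: after_dom PR_iff)

lemma item_gain_le_bound:
  assumes "\<psi> \<in> PR" "e \<in> E"
  shows "item_gain p f e \<psi> \<le> bound \<psi>"
  using val_le_bound[OF assms(1), of "Select e (\<lambda>_. Stop)"] val_nonneg[OF assms(1), of Stop]
  by (simp add: item_gain_eq after_val assms)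

text \<open>Realizations are extensional on \<open>E\<close>, so outside \<open>E\<close> the state
  seen is always \<open>undefined\<close>, and the intersection with \<open>E\<close> in
  \<open>util\<close> discards the item.\<close>

lemma val_Select_notin:
  assumes "\<psi> \<in> PR" "e \<notin> E"
  shows "val (Select e k) \<psi> = val (k undefined) \<psi>"
proof -
  have und: "\<phi> e = undefined" if "\<phi> \<in> set_pmf (posterior \<psi>)" for \<phi>
    using that assms prior by (auto simp: set_posterior)
  have "measure_pmf.expectation (selected (Select e k) \<phi>) (\<lambda>S. f ((dom \<psi> \<union> S) \<inter> E) \<phi>)
     = measure_pmf.expectation (selected (k undefined) \<phi>) (\<lambda>S. f ((dom \<psi> \<union> S) \<inter> E) \<phi>)"
    if "\<phi> \<in> set_pmf (posterior \<psi>)" for \<phi>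
    using assms(2) by (simp add: und[OF that])
  thus ?thesis
    unfolding val_nested(1)[OF assms(1)] by (rule expectation_cong_pmf)
qed

text \<open>Selecting \<open>e\<close> before or after the policy gives the same set. Hence
  \<open>e\<close> can be moved down to the leaves of the tree, where monotonicity for single items
  applies.\<close>

lemma val_mono:
  assumes "\<psi> \<in> PR" "e \<in> E"
  shows "val \<pi> \<psi> \<le> after e (val \<pi>) \<psi>"
  using assms(1)
proof (induction \<pi> arbitrary: \<psi>)
  case Stop
  thus ?case
    using item_gain_nonneg[of \<psi> e] assms(2) by (simp add: item_gain_eq)
next
  case (Select x k)
  show ?case
  proof (cases "x \<in> E")
    case True
    have "val (Select x k) \<psi> = measure_pmf.expectation (observe x \<psi>) (\<lambda>s. val (k s) (\<psi>(x \<mapsto> s)))"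
      using Select.prems True by (rule val_Select)
    also have "\<dots> \<le> measure_pmf.expectation (observe x \<psi>) (\<lambda>s. val (Select e (\<lambda>_. k s)) (\<psi>(x \<mapsto> s)))"
    proof (intro expectation_mono_pmf integrable_val_cont Select.prems True)
      fix s assume "s \<in> set_pmf (observe x \<psi>)"
      with Select.prems True have PR: "\<psi>(x \<mapsto> s) \<in> PR"
        by (rule upd_PR)
      show "val (k s) (\<psi>(x \<mapsto> s)) \<le> val (Select e (\<lambda>_. k s)) (\<psi>(x \<mapsto> s))"
        unfolding after_val[OF PR assms(2), symmetric] by (rule Select.IH[OF _ PR]) simp
    qed
    also have "\<dots> = val (Select x (\<lambda>s. Select e (\<lambda>_. k s))) \<psi>"
      using Select.prems True by (rule val_Select[symmetric])
    also have "\<dots> = val (Select e (\<lambda>_. Select x k)) \<psi>"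
      by (intro val_cong) (simp add: pmf.map_comp o_def insert_commute)
    finally show ?thesis
      using Select.prems assms(2) by (simp add: after_val)
  next
    case False
    have "val (Select x k) \<psi> = val (k undefined) \<psi>"
      using Select.prems False by (rule val_Select_notin)
    also have "\<dots> \<le> after e (val (k undefined)) \<psi>"
      using Select by blast
    also have "\<dots> = after e (val (Select x k)) \<psi>"
      unfolding after_def using upd_PR[OF Select.prems assms(2)] False
      by (intro expectation_cong_pmf val_Select_notin[symmetric])
    finally show ?thesis .
  qed
next
  case (Toss D)
  let ?D = "map_pmf (\<lambda>\<pi>. Select e (\<lambda>_. \<pi>)) D"
  have "val (Toss D) \<psi> = measure_pmf.expectation D (\<lambda>\<pi>. val \<pi> \<psi>)"
    using Toss.prems by (rule val_Toss)
  also have "\<dots> \<le> measure_pmf.expectation D (\<lambda>\<pi>. val (Select e (\<lambda>_. \<pi>)) \<psi>)"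
  proof (rule expectation_mono_pmf)
    show "integrable (measure_pmf D) (\<lambda>\<pi>. val (Select e (\<lambda>_. \<pi>)) \<psi>)"
      using integrable_val_Toss[OF Toss.prems, of ?D] by simp
    show "val \<pi> \<psi> \<le> val (Select e (\<lambda>_. \<pi>)) \<psi>" if "\<pi> \<in> set_pmf D" for \<pi>
      using Toss.IH[OF that Toss.prems] Toss.prems assms(2) by (simp add: after_val)
  qed (rule integrable_val_Toss[OF Toss.prems])
  also have "\<dots> = val (Toss ?D) \<psi>"
    by (simp add: val_Toss[OF Toss.prems])
  also have "\<dots> = val (Select e (\<lambda>_. Toss D)) \<psi>"
    by (intro val_cong) (simp add: join_pmf_def map_bind_pmf bind_map_pmf)
  finally show ?case
    using Toss.prems assms(2) by (simp add: after_val)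
qed

section \<open>The best gain within a set and a budget\<close>

text \<open>Has the same shape as the suprema in \<open>fully_adaptive_submodular\<close>, which
  thereby becomes antitonicity of \<open>best\<close>. In place of a maximizing policy,
  \<open>near_best\<close> supplies one that is optimal up to \<open>\<delta>\<close>.\<close>

definition best :: "'e set \<Rightarrow> nat \<Rightarrow> ('e \<rightharpoonup> 'o) \<Rightarrow> real" where
  "best V a \<psi> = (SUP \<pi>\<in>policies_on E Os V a. policy_gain p f \<pi> \<psi>)"

lemma Stop_policies_on: "Stop \<in> policies_on E Os V a"
  by (simp add: policies_on_def)

lemma policies_on_gain:
  assumes "\<psi> \<in> PR" "V \<subseteq> E" "\<pi> \<in> policies_on E Os V a"
  shows "policy_gain p f \<pi> \<psi> = val \<pi> \<psi> - val Stop \<psi>"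
proof (rule policy_gain_eq[OF assms(1)])
  fix \<phi> S assume "\<phi> \<in> set_pmf p" "S \<in> set_pmf (selected \<pi> \<phi>)"
  moreover from this have "\<phi> \<in> E \<rightarrow>\<^sub>E Os"
    using prior by blast
  ultimately show "S \<subseteq> E"
    using assms unfolding policies_on_def by blast
qed

lemma policies_on_gain_le:
  assumes "\<psi> \<in> PR" "V \<subseteq> E" "\<pi> \<in> policies_on E Os V a"
  shows "policy_gain p f \<pi> \<psi> \<le> bound \<psi>"
  using policies_on_gain[OF assms] val_le_bound[OF assms(1), of \<pi>] val_nonneg[OF assms(1), of Stop]
  by linarith

lemma gain_le_best:
  assumes "\<psi> \<in> PR" "V \<subseteq> E" "\<pi> \<in> policies_on E Os V a"
  shows "val \<pi> \<psi> - val Stop \<psi> \<le> best V a \<psi>"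
  unfolding best_def policies_on_gain[OF assms, symmetric]
  by (rule cSUP_upper[OF assms(3)]) (rule bdd_aboveI2[OF policies_on_gain_le[OF assms(1,2)]])

lemma best_le:
  assumes "\<psi> \<in> PR" "V \<subseteq> E"
    and "\<And>\<pi>. \<pi> \<in> policies_on E Os V a \<Longrightarrow> val \<pi> \<psi> - val Stop \<psi> \<le> c"
  shows "best V a \<psi> \<le> c"
  unfolding best_def
proof (rule cSUP_least)
  show "policies_on E Os V a \<noteq> {}"
    using Stop_policies_on by blast
  show "policy_gain p f \<pi> \<psi> \<le> c" if "\<pi> \<in> policies_on E Os V a" for \<pi>
    unfolding policies_on_gain[OF assms(1,2) that] using that by (rule assms(3))
qed

lemma best_nonneg: "\<psi> \<in> PR \<Longrightarrow> V \<subseteq> E \<Longrightarrow> 0 \<le> best V a \<psi>"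
  using gain_le_best[OF _ _ Stop_policies_on, of \<psi> V a] by simp

lemma best_le_bound: "\<psi> \<in> PR \<Longrightarrow> V \<subseteq> E \<Longrightarrow> best V a \<psi> \<le> bound \<psi>"
  by (rule best_le) (simp_all add: policies_on_gain_le flip: policies_on_gain)

lemma controlled_best:
  assumes "V \<subseteq> E"
  shows "controlled (best V a)"
  by (rule controlledI[where c=1]) (simp add: best_nonneg best_le_bound assms)

lemma near_best:
  assumes "\<psi> \<in> PR" "V \<subseteq> E" "0 < \<delta>"
  shows "\<exists>\<pi>\<in>policies_on E Os V a. best V a \<psi> - \<delta> < val \<pi> \<psi> - val Stop \<psi>"
proof (rule ccontr)
  assume "\<not> ?thesis"
  hence "val \<pi> \<psi> - val Stop \<psi> \<le> best V a \<psi> - \<delta>" if "\<pi> \<in> policies_on E Os V a" for \<pi>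
    using that by (meson not_less)
  hence "best V a \<psi> \<le> best V a \<psi> - \<delta>"
    by (rule best_le[OF assms(1,2)])
  with assms(3) show False by simp
qed

lemma best_eq_0:
  assumes "\<psi> \<in> PR" "V \<subseteq> E" "V = {} \<or> a = 0"
  shows "best V a \<psi> = 0"
proof (rule antisym)
  show "best V a \<psi> \<le> 0"
  proof (rule best_le[OF assms(1,2)])
    fix \<pi> assume \<pi>: "\<pi> \<in> policies_on E Os V a"
    have no_item: "S = {}" if "\<phi> \<in> set_pmf (posterior \<psi>)" "S \<in> set_pmf (selected \<pi> \<phi>)" for \<phi> S
    proof -
      have "\<phi> \<in> E \<rightarrow>\<^sub>E Os"
        using that(1) prior assms(1) by (auto simp: set_posterior)
      hence "S \<subseteq> V" "card S \<le> a"
        using \<pi> that(2) unfolding policies_on_def by blast+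
      thus ?thesis
        using assms(2,3) finite_subset[OF _ finite_E, of S] by auto
    qed
    have "measure_pmf.expectation (selected \<pi> \<phi>) (\<lambda>S. f (dom \<psi> \<union> S) \<phi> - f (dom \<psi>) \<phi>) = 0"
      if "\<phi> \<in> set_pmf (posterior \<psi>)" for \<phi>
      by (subst expectation_cong_pmf[where g="\<lambda>_. 0"]) (auto dest!: no_item[OF that])
    hence "policy_gain p f \<pi> \<psi> = 0"
      unfolding policy_gain_def posterior_def[symmetric]
      by (subst expectation_cong_pmf[where g="\<lambda>_. 0"]) auto
    thus "val \<pi> \<psi> - val Stop \<psi> \<le> 0"
      using policies_on_gain[OF assms(1,2) \<pi>] by simp
  qed
qed (rule best_nonneg[OF assms(1,2)])

text \<open>Submodularity speaks only of budgets from 1 to \<open>card V\<close>. A larger budget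
  admits the same policies as \<open>card V\<close>, and in the degenerate cases both sides are
  0.\<close>

lemma best_antimono:
  assumes "\<psi> \<in> PR" "\<psi>' \<in> PR" "\<psi> \<subseteq>\<^sub>m \<psi>'" "V \<subseteq> E"
  shows "best V a \<psi>' \<le> best V a \<psi>"
proof (cases "V = {} \<or> a = 0")
  case True
  thus ?thesis using assms by (simp add: best_eq_0)
next
  case False
  have fin: "finite V"
    using assms(4) finite_E by (rule finite_subset)
  have eq: "best V a \<psi>'' = best V (min a (card V)) \<psi>''" for \<psi>''
  proof -
    have "policies_on E Os V a = policies_on E Os V (min a (card V))"
      unfolding policies_on_def using card_mono[OF fin] by fastforce
    thus ?thesis by (simp add: best_def)
  qed
  have "min a (card V) \<in> {1..card V}"
    using False fin card_gt_0_iff[of V] by auto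
  thus ?thesis
    unfolding eq using submodular assms unfolding fully_adaptive_submodular_def best_def by blast
qed

lemma best_upd_le:
  assumes "\<psi> \<in> PR" "e \<in> E" "V \<subseteq> E"
  shows "after e (best V a) \<psi> \<le> best V a \<psi>"
  using assms by (intro after_le controlled_best best_antimono upd_PR upd_extends)

text \<open>By \<open>val_mono\<close> any policy may let \<open>e\<close> go first without loss.
  The value then splits into the gain of \<open>e\<close> and the expected gain of the policy on top
  of it.\<close>

lemma best_le_after:
  assumes "\<psi> \<in> PR" "e \<in> E" "V \<subseteq> E"
  shows "best V a \<psi> \<le> item_gain p f e \<psi> + after e (best V a) \<psi>"
proof (rule best_le[OF assms(1,3)])
  fix \<pi> assume \<pi>: "\<pi> \<in> policies_on E Os V a"
  have "val \<pi> \<psi> - val Stop \<psi> \<le> after e (val \<pi>) \<psi> - val Stop \<psi>"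
    using val_mono assms by simp
  also have "\<dots> = item_gain p f e \<psi> + after e (\<lambda>\<psi>. val \<pi> \<psi> - val Stop \<psi>) \<psi>"
    using assms by (simp add: item_gain_eq after_diff controlled_val)
  also have "after e (\<lambda>\<psi>. val \<pi> \<psi> - val Stop \<psi>) \<psi> \<le> after e (best V a) \<psi>"
    using assms \<pi> by (intro after_mono controlled_diff controlled_val controlled_best gain_le_best upd_PR)
  finally show "val \<pi> \<psi> - val Stop \<psi> \<le> item_gain p f e \<psi> + after e (best V a) \<psi>" by simp
qed

text \<open>Selecting \<open>e\<close> and then continuing with a nearly optimal policy, chosen
  separately for each observed state, is a policy with budget \<open>Suc a\<close>.\<close>

lemma best_Suc:
  assumes \<psi>: "\<psi> \<in> PR" and V: "V \<subseteq> E" and e: "e \<in> V"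
  shows "item_gain p f e \<psi> + after e (best V a) \<psi> \<le> best V (Suc a) \<psi>"
proof (rule field_le_epsilon)
  fix \<delta> :: real assume \<delta>: "0 < \<delta>"
  have eE: "e \<in> E" using e V by blast
  \<comment> \<open>Membership in \<open>policies_on\<close> concerns all realizations, also those
    of probability zero, so a continuation is needed for every \<open>s\<close>. Where the extended
    map is not a partial realization, \<open>Stop\<close> will do.\<close>
  have "\<forall>s. \<exists>\<pi>. \<pi> \<in> policies_on E Os V a \<and>
    (\<psi>(e \<mapsto> s) \<in> PR \<longrightarrow> best V a (\<psi>(e \<mapsto> s)) - \<delta> < val \<pi> (\<psi>(e \<mapsto> s)) - val Stop (\<psi>(e \<mapsto> s)))"
    using near_best[OF _ V \<delta>] Stop_policies_on by blast
  from choice[OF this] obtain k where k: "k s \<in> policies_on E Os V a"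
    "\<psi>(e \<mapsto> s) \<in> PR \<Longrightarrow> best V a (\<psi>(e \<mapsto> s)) - \<delta> < val (k s) (\<psi>(e \<mapsto> s)) - val Stop (\<psi>(e \<mapsto> s))" for s
    by blast
  have "Select e k \<in> policies_on E Os V (Suc a)"
    unfolding policies_on_def mem_Collect_eq
  proof (intro ballI)
    fix \<phi> S assume \<phi>: "\<phi> \<in> E \<rightarrow>\<^sub>E Os" and "S \<in> set_pmf (selected (Select e k) \<phi>)"
    then obtain S' where S': "S = insert e S'" "S' \<in> set_pmf (selected (k (\<phi> e)) \<phi>)"
      by auto
    hence "S' \<subseteq> V" "card S' \<le> a"
      using k(1)[of "\<phi> e"] \<phi> unfolding policies_on_def by blast+
    thus "S \<subseteq> V \<and> card S \<le> Suc a"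
      using e card_insert_le_m1[of "Suc a" S' e] S'(1) by simp
  qed
  hence "val (Select e k) \<psi> - val Stop \<psi> \<le> best V (Suc a) \<psi>"
    by (rule gain_le_best[OF \<psi> V])
  moreover have "after e (\<lambda>\<psi>. best V a \<psi> + val Stop \<psi> + (- \<delta>)) \<psi> \<le> val (Select e k) \<psi>"
    unfolding val_Select[OF \<psi> eE] unfolding after_def
  proof (intro expectation_mono_pmf integrable_val_cont \<psi> eE Bochner_Integration.integrable_add)
    fix s assume "s \<in> set_pmf (observe e \<psi>)"
    hence "\<psi>(e \<mapsto> s) \<in> PR"
      using \<psi> eE by (intro upd_PR)
    thus "best V a (\<psi>(e \<mapsto> s)) + val Stop (\<psi>(e \<mapsto> s)) + (- \<delta>) \<le> val (k s) (\<psi>(e \<mapsto> s))"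
      using k(2)[of s] by linarith
  qed (use integrable_controlled \<psi> eE controlled_best[OF V] controlled_val in auto)
  moreover have "after e (\<lambda>\<psi>. best V a \<psi> + val Stop \<psi> + (- \<delta>)) \<psi>
      = after e (best V a) \<psi> + after e (val Stop) \<psi> - \<delta>"
    unfolding after_def
    using integrable_controlled[OF controlled_best[OF V] \<psi> eE] integrable_controlled[OF controlled_val \<psi> eE]
    by simp
  ultimately show "item_gain p f e \<psi> + after e (best V a) \<psi> \<le> best V (Suc a) \<psi> + \<delta>"
    using item_gain_eq[OF \<psi> eE] by linarith
qed


section \<open>Upper bounds on policy gains by potentials\<close>

lemma set_posterior_nonempty: "\<exists>\<phi>. \<phi> \<in> set_pmf (posterior \<psi>)"
  using set_pmf_not_empty by fast

text \<open>\<open>U A \<psi>\<close> is an allowance for what a policy can still gain after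
  selecting \<open>A\<close>: by \<open>step\<close>, each new item is paid for by the expected drop
  of the allowance. \<open>A\<close> is kept apart from \<open>dom \<psi>\<close> because items
  observed before the policy starts do not use up its budget, and count when the policy selects them
  itself.\<close>

lemma gain_le_potential:
  fixes U :: "'e set \<Rightarrow> ('e \<rightharpoonup> 'o) \<Rightarrow> real"
  assumes ctrl: "\<And>A. controlled (U A)"
    and nonneg: "\<And>A \<psi>. ok A \<Longrightarrow> \<psi> \<in> PR \<Longrightarrow> 0 \<le> U A \<psi>"
    and step: "\<And>A e \<psi>. ok (insert e A) \<Longrightarrow> \<psi> \<in> PR \<Longrightarrow> e \<notin> A \<Longrightarrow>
      item_gain p f e \<psi> + after e (U (insert e A)) \<psi> \<le> U A \<psi>"
    and ok_E: "\<And>A. ok A \<Longrightarrow> A \<subseteq> E"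
    and ok_mono: "\<And>A A'. ok A \<Longrightarrow> A' \<subseteq> A \<Longrightarrow> ok A'"
  shows "\<psi> \<in> PR \<Longrightarrow> A \<subseteq> dom \<psi> \<Longrightarrow>
    (\<And>\<phi> S. \<phi> \<in> set_pmf (posterior \<psi>) \<Longrightarrow> S \<in> set_pmf (selected \<pi> \<phi>) \<Longrightarrow> ok (A \<union> S)) \<Longrightarrow>
    val \<pi> \<psi> - val Stop \<psi> \<le> U A \<psi>"
proof (induction \<pi> arbitrary: A \<psi>)
  case Stop
  thus ?case
    using set_posterior_nonempty[of \<psi>] nonneg[of A \<psi>] by auto
next
  case (Select x k)
  \<comment> \<open>The hypothesis constrains only final selected sets. Some realization and coin
    outcome exist, so the current set is contained in a final one, and \<open>ok\<close> passes down
    to it.\<close>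
  obtain \<phi> where \<phi>: "\<phi> \<in> set_pmf (posterior \<psi>)"
    using set_posterior_nonempty by blast
  obtain S where "S \<in> set_pmf (selected (k (\<phi> x)) \<phi>)"
    using set_pmf_not_empty by fast
  hence "insert x S \<in> set_pmf (selected (Select x k) \<phi>)" by simp
  hence "ok (A \<union> insert x S)"
    by (rule Select.prems(3)[OF \<phi>])
  hence ok: "ok (insert x A)"
    by (rule ok_mono) auto
  hence x: "x \<in> E"
    using ok_E by blast
  have IH: "val (k s) (\<psi>(x \<mapsto> s)) - val Stop (\<psi>(x \<mapsto> s)) \<le> U (insert x A) (\<psi>(x \<mapsto> s))"
    if s: "s \<in> set_pmf (observe x \<psi>)" for s
  proof (rule Select.IH)
    show PR: "\<psi>(x \<mapsto> s) \<in> PR"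
      using Select.prems(1) x s by (rule upd_PR)
    show "insert x A \<subseteq> dom (\<psi>(x \<mapsto> s))"
      using Select.prems(2) by auto
    fix \<phi> S assume \<phi>: "\<phi> \<in> set_pmf (posterior (\<psi>(x \<mapsto> s)))" and S: "S \<in> set_pmf (selected (k s) \<phi>)"
    have "\<phi> \<in> set_pmf (bind_pmf (observe x \<psi>) (\<lambda>s. posterior (\<psi>(x \<mapsto> s))))"
      using s \<phi> by auto
    hence "\<phi> \<in> set_pmf (posterior \<psi>)"
      unfolding bind_observe_posterior[OF Select.prems(1) x] .
    moreover have "\<phi> x = s"
      using \<phi> by (simp add: set_posterior[OF PR] agrees_def)
    hence "insert x S \<in> set_pmf (selected (Select x k) \<phi>)"
      using S by simp
    ultimately have "ok (A \<union> insert x S)"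
      by (rule Select.prems(3))
    thus "ok (insert x A \<union> S)" by simp
  qed simp
  have "val (Select x k) \<psi> \<le> after x (\<lambda>\<psi>. U (insert x A) \<psi> + val Stop \<psi>) \<psi>"
    unfolding val_Select[OF Select.prems(1) x] unfolding after_def
  proof (intro expectation_mono_pmf integrable_val_cont Bochner_Integration.integrable_add
      integrable_controlled Select.prems(1) x ctrl controlled_val)
    fix s assume "s \<in> set_pmf (observe x \<psi>)"
    from IH[OF this] show "val (k s) (\<psi>(x \<mapsto> s)) \<le> U (insert x A) (\<psi>(x \<mapsto> s)) + val Stop (\<psi>(x \<mapsto> s))"
      by simp
  qed
  also have "\<dots> = after x (U (insert x A)) \<psi> + after x (val Stop) \<psi>"
    by (intro after_add ctrl controlled_val Select.prems(1) x)
  finally have le: "val (Select x k) \<psi> - val Stop \<psi> \<le> item_gain p f x \<psi> + after x (U (insert x A)) \<psi>"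
    by (simp add: item_gain_eq[OF Select.prems(1) x])
  show ?case
  \<comment> \<open>The potential need not drop at a repeated selection: such an item is already
    observed, so it has gain 0 and leaves \<open>\<psi>\<close> unchanged.\<close>
  proof (cases "x \<in> A")
    case True
    hence "x \<in> dom \<psi>"
      using Select.prems(2) by blast
    thus ?thesis
      using le True by (simp add: item_gain_dom after_dom Select.prems(1) insert_absorb)
  next
    case False
    thus ?thesis
      using le step[OF ok Select.prems(1)] by linarith
  qed
next
  case (Toss D)
  have "val (Toss D) \<psi> \<le> measure_pmf.expectation D (\<lambda>_. U A \<psi> + val Stop \<psi>)"
    unfolding val_Toss[OF Toss.prems(1)]
  proof (intro expectation_mono_pmf integrable_val_Toss Toss.prems(1))
    fix \<pi> assume \<pi>: "\<pi> \<in> set_pmf D"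
    have "val \<pi> \<psi> - val Stop \<psi> \<le> U A \<psi>"
    proof (rule Toss.IH[OF \<pi> Toss.prems(1,2)])
      fix \<phi> S assume "\<phi> \<in> set_pmf (posterior \<psi>)" "S \<in> set_pmf (selected \<pi> \<phi>)"
      thus "ok (A \<union> S)"
        using \<pi> by (intro Toss.prems(3)) auto
    qed
    thus "val \<pi> \<psi> \<le> U A \<psi> + val Stop \<psi>" by simp
  qed simp
  thus ?case by simp
qed

text \<open>The potential is the sum of the best gains under the remaining budgets. A new item is
  paid for by its own group through \<open>best_Suc\<close>, while the terms of the other groups do
  not increase in expectation, by submodularity.\<close>

lemma gain_le_sum_best:
  assumes \<psi>: "\<psi> \<in> PR" and I: "finite I" and disj: "disjoint_family_on B I"
    and B: "\<And>i. i \<in> I \<Longrightarrow> B i \<subseteq> E"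
    and sel: "\<And>\<phi> S. \<phi> \<in> set_pmf p \<Longrightarrow> S \<in> set_pmf (selected \<pi> \<phi>) \<Longrightarrow>
      S \<subseteq> (\<Union>i\<in>I. B i) \<and> (\<forall>i\<in>I. card (S \<inter> B i) \<le> d i)"
  shows "val \<pi> \<psi> - val Stop \<psi> \<le> (\<Sum>i\<in>I. best (B i) (d i) \<psi>)"
proof -
  define ok where "ok A \<longleftrightarrow> A \<subseteq> (\<Union>i\<in>I. B i) \<and> (\<forall>i\<in>I. card (A \<inter> B i) \<le> d i)" for A
  define U where "U A \<psi> = (\<Sum>i\<in>I. best (B i) (d i - card (A \<inter> B i)) \<psi>)" for A \<psi>
  have finB: "finite (B i)" if "i \<in> I" for i
    using B[OF that] finite_E by (rule finite_subset)
  have "val \<pi> \<psi> - val Stop \<psi> \<le> U {} \<psi>"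
  proof (rule gain_le_potential[of U ok])
    show "controlled (U A)" for A
      unfolding U_def using B by (intro controlled_sum controlled_best)
    show "0 \<le> U A \<psi>" if "\<psi> \<in> PR" for A \<psi>
      unfolding U_def using B that by (intro sum_nonneg best_nonneg)
    show "A \<subseteq> E" if "ok A" for A
      using that B unfolding ok_def by blast
    show "ok A'" if "ok A" "A' \<subseteq> A" for A A'
    proof -
      have "card (A' \<inter> B i) \<le> d i" if "i \<in> I" for i
      proof -
        have "card (A' \<inter> B i) \<le> card (A \<inter> B i)"
          using finB[OF that] \<open>A' \<subseteq> A\<close> by (intro card_mono) auto
        also have "\<dots> \<le> d i"
          using \<open>ok A\<close> that unfolding ok_def by blast
        finally show ?thesis .
      qed
      thus ?thesis
        using that unfolding ok_def by blast
    qed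
    fix A e \<psi> assume ok: "ok (insert e A)" and \<psi>: "\<psi> \<in> PR" and e: "e \<notin> A"
    obtain j where j: "j \<in> I" "e \<in> B j"
      using ok unfolding ok_def by blast
    have eE: "e \<in> E" using j B by blast
    have "after e (U (insert e A)) \<psi> = (\<Sum>i\<in>I. after e (best (B i) (d i - card (insert e A \<inter> B i))) \<psi>)"
      unfolding U_def using B by (intro after_sum controlled_best \<psi> eE)
    also have "\<dots> = after e (best (B j) (d j - card (insert e A \<inter> B j))) \<psi>
        + (\<Sum>i\<in>I-{j}. after e (best (B i) (d i - card (insert e A \<inter> B i))) \<psi>)"
      using I j(1) by (rule sum.remove)
    also have "(\<Sum>i\<in>I-{j}. after e (best (B i) (d i - card (insert e A \<inter> B i))) \<psi>)
        \<le> (\<Sum>i\<in>I-{j}. best (B i) (d i - card (A \<inter> B i)) \<psi>)"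
    proof (rule sum_mono)
      fix i assume i: "i \<in> I - {j}"
      hence "e \<notin> B i"
        using disj j unfolding disjoint_family_on_def by blast
      hence "insert e A \<inter> B i = A \<inter> B i" by blast
      thus "after e (best (B i) (d i - card (insert e A \<inter> B i))) \<psi> \<le> best (B i) (d i - card (A \<inter> B i)) \<psi>"
        using i B by (auto intro: best_upd_le \<psi> eE)
    qed
    also have "item_gain p f e \<psi> + (after e (best (B j) (d j - card (insert e A \<inter> B j))) \<psi>)
        \<le> best (B j) (d j - card (A \<inter> B j)) \<psi>"
    proof -
      have "card (insert e A \<inter> B j) = Suc (card (A \<inter> B j))"
        using e j(2) finB[OF j(1)] by (simp add: card_insert_if)
      moreover have "card (insert e A \<inter> B j) \<le> d j"
        using ok j unfolding ok_def by blast
      ultimately have "d j - card (A \<inter> B j) = Suc (d j - card (insert e A \<inter> B j))" by simp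
      thus ?thesis
        using best_Suc[OF \<psi> B[OF j(1)] j(2)] by simp
    qed
    moreover have "U A \<psi> = best (B j) (d j - card (A \<inter> B j)) \<psi>
        + (\<Sum>i\<in>I-{j}. best (B i) (d i - card (A \<inter> B i)) \<psi>)"
      unfolding U_def using I j(1) by (rule sum.remove)
    ultimately show "item_gain p f e \<psi> + after e (U (insert e A)) \<psi> \<le> U A \<psi>"
      by linarith
  next
    show "ok ({} \<union> S)" if "\<phi> \<in> set_pmf (posterior \<psi>)" "S \<in> set_pmf (selected \<pi> \<phi>)" for \<phi> S
      using sel[of \<phi> S] that unfolding ok_def by (simp add: set_posterior[OF \<psi>])
  qed (simp_all add: \<psi>)
  thus ?thesis by (simp add: U_def)
qed

text \<open>Turns item gains into instances of \<open>best\<close>, so that full adaptive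
  submodularity yields diminishing returns for single items.\<close>

lemma best_singleton:
  assumes "\<psi> \<in> PR" "e \<in> E"
  shows "best {e} 1 \<psi> = item_gain p f e \<psi>"
proof (rule antisym)
  show "best {e} 1 \<psi> \<le> item_gain p f e \<psi>"
  proof (rule best_le[OF assms(1)])
    fix \<pi> assume \<pi>: "\<pi> \<in> policies_on E Os {e} 1"
    define U where "U A = (if e \<in> A then (\<lambda>_. 0) else item_gain p f e)" for A
    have ctrl: "controlled (item_gain p f e)"
      by (rule controlledI[where c=1]) (simp add: item_gain_nonneg item_gain_le_bound assms(2))
    have "val \<pi> \<psi> - val Stop \<psi> \<le> U {} \<psi>"
    proof (rule gain_le_potential[of U "\<lambda>A. A \<subseteq> {e}"])
      show "controlled (U A)" for A
        using ctrl controlledI[of "\<lambda>_. 0" 0] by (simp add: U_def)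
      show "0 \<le> U A \<psi>" if "\<psi> \<in> PR" for A \<psi>
        using that assms(2) by (simp add: U_def item_gain_nonneg)
      show "item_gain p f x \<psi> + after x (U (insert x A)) \<psi> \<le> U A \<psi>"
        if "insert x A \<subseteq> {e}" "x \<notin> A" for x A \<psi>
        using that by (auto simp: U_def)
      show "{} \<union> S \<subseteq> {e}" if "\<phi> \<in> set_pmf (posterior \<psi>)" "S \<in> set_pmf (selected \<pi> \<phi>)" for \<phi> S
        using \<pi> that prior unfolding policies_on_def by (auto simp: set_posterior[OF assms(1)])
    qed (use assms in auto)
    thus "val \<pi> \<psi> - val Stop \<psi> \<le> item_gain p f e \<psi>"
      by (simp add: U_def)
  qed (use assms(2) in simp)
  have "after e (best {e} 0) \<psi> = 0"
    unfolding after_def using upd_PR[OF assms] assms(2)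
    by (subst expectation_cong_pmf[where g="\<lambda>_. 0"]) (auto intro!: best_eq_0)
  thus "item_gain p f e \<psi> \<le> best {e} 1 \<psi>"
    using best_Suc[OF assms(1), of "{e}" e 0] assms(2) by simp
qed

lemma item_gain_upd_le:
  assumes "\<psi> \<in> PR" "e \<in> E" "x \<in> E" "s \<in> set_pmf (observe x \<psi>)"
  shows "item_gain p f e (\<psi>(x \<mapsto> s)) \<le> item_gain p f e \<psi>"
  unfolding best_singleton[OF assms(1,2), symmetric]
    best_singleton[OF upd_PR[OF assms(1,3,4)] assms(2), symmetric]
  using assms by (intro best_antimono upd_PR upd_extends) auto

text \<open>Item gains only shrink as more is observed, so adaptivity cannot beat the best fixed
  choice of at most \<open>k\<close> gains read off at the present state. The potential is the best
  completion of the items selected so far.\<close>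

lemma best_le_sum_item_gain:
  assumes \<psi>: "\<psi> \<in> PR" and V: "V \<subseteq> E"
  shows "\<exists>T\<subseteq>V. card T \<le> k \<and> best V k \<psi> \<le> (\<Sum>e\<in>T. item_gain p f e \<psi>)"
proof -
  define C where "C A = {T. T \<subseteq> V - A \<and> card T + card A \<le> k}" for A
  \<comment> \<open>The extra 0 keeps the maximum defined when \<open>A\<close> exceeds the budget
    and \<open>C A\<close> is empty.\<close>
  define U where "U A \<psi> = Max ((\<lambda>T. \<Sum>e\<in>T. item_gain p f e \<psi>) ` C A \<union> {0})" for A \<psi>
  have finV: "finite V"
    using V finite_E by (rule finite_subset)
  have finC: "finite (C A)" for A
    by (rule finite_subset[of _ "Pow V"]) (auto simp: C_def finV)
  have sum_le: "(\<Sum>e\<in>T. item_gain p f e \<psi>) \<le> real (card V) * bound \<psi>"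
    if "T \<subseteq> V" "\<psi> \<in> PR" for T \<psi>
  proof -
    have "(\<Sum>e\<in>T. item_gain p f e \<psi>) \<le> (\<Sum>e\<in>T. bound \<psi>)"
      using that V by (intro sum_mono item_gain_le_bound) auto
    also have "\<dots> = real (card T) * bound \<psi>" by simp
    also have "\<dots> \<le> real (card V) * bound \<psi>"
      using card_mono[OF finV that(1)] bound_nonneg[OF that(2)] by (intro mult_right_mono) auto
    finally show ?thesis .
  qed
  have U_nonneg: "0 \<le> U A \<psi>" for A \<psi>
    unfolding U_def using finC by (intro Max_ge) auto
  have U_ge: "(\<Sum>e\<in>T. item_gain p f e \<psi>) \<le> U A \<psi>" if "T \<in> C A" for T A \<psi>
    unfolding U_def using finC that by (intro Max_ge) auto
  have ctrl: "controlled (U A)" for A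
  proof (rule controlledI)
    fix \<psi> assume "\<psi> \<in> PR"
    hence "U A \<psi> \<le> real (card V) * bound \<psi>"
      unfolding U_def using finC sum_le bound_nonneg
      by (intro Max.boundedI) (auto simp: C_def subset_iff)
    thus "\<bar>U A \<psi>\<bar> \<le> real (card V) * bound \<psi>"
      using U_nonneg by simp
  qed
  have gain_le: "val \<pi> \<psi> - val Stop \<psi> \<le> U {} \<psi>" if \<pi>: "\<pi> \<in> policies_on E Os V k" for \<pi>
  proof (rule gain_le_potential[of U "\<lambda>A. A \<subseteq> V \<and> card A \<le> k"])
    show "controlled (U A)" for A by (rule ctrl)
    show "0 \<le> U A \<psi>" for A \<psi> by (rule U_nonneg)
    show "A \<subseteq> E" if "A \<subseteq> V \<and> card A \<le> k" for A using that V by blast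
    show "A' \<subseteq> V \<and> card A' \<le> k" if "A \<subseteq> V \<and> card A \<le> k" "A' \<subseteq> A" for A A'
      using that card_mono[of A A'] finite_subset[OF _ finV, of A] by auto
    show "{} \<union> S \<subseteq> V \<and> card ({} \<union> S) \<le> k"
      if "\<phi> \<in> set_pmf (posterior \<psi>)" "S \<in> set_pmf (selected \<pi> \<phi>)" for \<phi> S
      using \<pi> that prior unfolding policies_on_def by (auto simp: set_posterior[OF \<psi>])
    fix A e \<psi>
    assume A: "insert e A \<subseteq> V \<and> card (insert e A) \<le> k" and \<psi>: "\<psi> \<in> PR" and e: "e \<notin> A"
    have finA: "finite A"
      using A finV by (meson finite_subset insert_subset)
    have eE: "e \<in> E" using A V by blast
    have sum_T: "(\<Sum>x\<in>T. item_gain p f x \<psi>) \<le> U A \<psi> - item_gain p f e \<psi>" if "T \<in> C (insert e A)" for T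
    proof -
      have T: "finite T" "e \<notin> T"
        using that finite_subset[OF _ finV, of T] unfolding C_def by auto
      moreover have "insert e T \<in> C A"
        using that A e finA T unfolding C_def by auto
      ultimately have T: "finite T" "e \<notin> T" "insert e T \<in> C A"
        by blast+
      thus ?thesis
        using U_ge[OF T(3), of \<psi>] by simp
    qed
    have "{} \<in> C (insert e A)"
      using A by (auto simp: C_def)
    note sum_empty = sum_T[OF this]
    have "after e (U (insert e A)) \<psi> \<le> U A \<psi> - item_gain p f e \<psi>"
    proof (rule after_le[OF ctrl \<psi> eE])
      fix s assume s: "s \<in> set_pmf (observe e \<psi>)"
      have "(\<Sum>x\<in>T. item_gain p f x (\<psi>(e \<mapsto> s))) \<le> U A \<psi> - item_gain p f e \<psi>" if T: "T \<in> C (insert e A)" for T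
      proof -
        have "(\<Sum>x\<in>T. item_gain p f x (\<psi>(e \<mapsto> s))) \<le> (\<Sum>x\<in>T. item_gain p f x \<psi>)"
          using T V by (intro sum_mono item_gain_upd_le[OF \<psi> _ eE s]) (auto simp: C_def)
        thus ?thesis
          using sum_T[OF T] by linarith
      qed
      thus "U (insert e A) (\<psi>(e \<mapsto> s)) \<le> U A \<psi> - item_gain p f e \<psi>"
        unfolding U_def[of "insert e A"] using finC sum_empty by (intro Max.boundedI) auto
    qed
    thus "item_gain p f e \<psi> + after e (U (insert e A)) \<psi> \<le> U A \<psi>" by simp
  qed (use \<psi> in auto)
  have "best V k \<psi> \<le> U {} \<psi>"
    by (rule best_le[OF \<psi> V gain_le])
  moreover have "U {} \<psi> \<in> (\<lambda>T. \<Sum>e\<in>T. item_gain p f e \<psi>) ` C {} \<union> {0}"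
    unfolding U_def using finC by (intro Max_in) auto
  moreover have "{} \<in> C {}" by (simp add: C_def)
  ultimately obtain T where "T \<in> C {}" "best V k \<psi> \<le> (\<Sum>e\<in>T. item_gain p f e \<psi>)"
    by fastforce
  thus ?thesis
    by (auto simp: C_def)
qed

end

section \<open>Random samples from a group\<close>

text \<open>Bounds the probability that a random \<open>s\<close>-subset of \<open>m\<close> items
  misses \<open>t\<close> given ones. As long as the left side is not zero, the quotient of the
  binomials is the product of the factors \<open>1 - s / (m - i)\<close> for \<open>i < t\<close>,
  each at most \<open>1 - s / m\<close>.\<close>

lemma binomial_diff_le:
  assumes "t \<le> m" "s \<le> m"
  shows "real ((m - t) choose s) \<le> real (m choose s) * (1 - real s / real m) ^ t"
  using assms(1)
proof (induction t)
  case (Suc t)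
  define q where "q = m - Suc t"
  have q: "m - t = Suc q"
    using Suc.prems by (simp add: q_def)
  have "real (q choose s) \<le> real (Suc q choose s) * (1 - real s / real m)"
  proof (cases "s \<le> q")
    case True
    have "Suc q * (q choose s) = (Suc q - s) * (Suc q choose s)"
      using binomial_absorb_comp[of "Suc q" s] by simp
    hence "real (Suc q) * real (q choose s) = (real (Suc q) - real s) * real (Suc q choose s)"
      using True by (metis Suc_leD le_SucI of_nat_diff of_nat_mult)
    hence "real (q choose s) = real (Suc q choose s) * (1 - real s / real (Suc q))"
      by (simp add: field_simps)
    also have "\<dots> \<le> real (Suc q choose s) * (1 - real s / real m)"
      using Suc.prems q by (intro mult_left_mono diff_left_mono divide_left_mono) auto
    finally show ?thesis .
  next
    case False
    moreover have "real s / real m \<le> 1"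
      using assms(2) by (cases "m = 0") auto
    ultimately show ?thesis by (simp add: binomial_eq_0)
  qed
  also have "\<dots> \<le> real (m choose s) * (1 - real s / real m) ^ t * (1 - real s / real m)"
    using Suc assms(2) unfolding q[symmetric] by (intro mult_right_mono) (auto simp: divide_le_eq_1)
  finally show ?case
    by (simp add: q_def mult_ac)
qed simp

text \<open>The sample size makes the avoidance probability at most
  \<open>exp (t / k * ln \<epsilon>)\<close>. Convexity replaces this by the chord between
  \<open>t = 0\<close> and \<open>t = k\<close>. A bound linear in \<open>t\<close> is the aim,
  since \<open>t\<close> then cancels when the loss is spread over the \<open>t\<close>
  items.\<close>

lemma sample_avoids_le:
  fixes \<epsilon> :: real
  assumes fin: "finite V" and k: "0 < k" and \<epsilon>: "0 < \<epsilon>" "\<epsilon> < 1" and t: "0 < t" "t \<le> card V" "t \<le> k"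
  defines "s \<equiv> sample_size V k \<epsilon>"
  shows "real ((card V - t) choose s) \<le> real (card V choose s) * (1 - real t / real k * (1 - \<epsilon>))"
proof -
  define m where "m = card V"
  have m: "0 < m" using t m_def by simp
  have x: "0 \<le> real t / real k" "real t / real k \<le> 1"
    using t k by auto
  have nn: "0 \<le> 1 - real t / real k * (1 - \<epsilon>)"
    using mult_le_one[of "real t / real k" "1 - \<epsilon>"] x \<epsilon> by simp
  show ?thesis
  proof (cases "s = m")
    case True
    \<comment> \<open>The sample is all of \<open>V\<close> and cannot miss a nonempty set. This
      includes the case where the cap in \<open>sample_size\<close> takes effect and the logarithmic
      lower bound on \<open>s\<close> is lost.\<close>
    hence "(card V - t) choose s = 0"
      using t m_def by (intro binomial_eq_0) simp
    thus ?thesis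
      using mult_nonneg_nonneg[OF of_nat_0_le_iff nn] by (simp only: of_nat_0)
  next
    case False
    hence "s \<noteq> card V" "s = min (card V) (nat \<lceil>real (card V) / real k * ln (1 / \<epsilon>)\<rceil>)"
      by (auto simp: s_def sample_size_def m_def)
    hence s: "s \<le> m" "s = nat \<lceil>real m / real k * ln (1 / \<epsilon>)\<rceil>"
      unfolding m_def by (metis min.cobounded1, metis min_def)
    hence "real m / real k * ln (1 / \<epsilon>) \<le> real s"
      by (simp add: of_nat_ceiling)
    hence sm: "1 / real k * ln (1 / \<epsilon>) \<le> real s / real m"
      using m by (simp add: field_simps)
    have "real ((m - t) choose s) \<le> real (m choose s) * (1 - real s / real m) ^ t"
      using t s m_def by (intro binomial_diff_le) auto
    also have "(1 - real s / real m) ^ t \<le> exp (- (real s / real m)) ^ t"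
      using exp_ge_add_one_self[of "- (real s / real m)"] s m by (intro power_mono) auto
    also have "\<dots> = exp (real t * (- (real s / real m)))"
      by (rule exp_of_nat_mult[symmetric])
    also have "\<dots> \<le> exp (real t * (- (1 / real k * ln (1 / \<epsilon>))))"
      using sm by (intro iffD2[OF exp_le_cancel_iff] mult_left_mono) auto
    also have "real t * (- (1 / real k * ln (1 / \<epsilon>))) = (1 - real t / real k) * 0 + real t / real k * ln \<epsilon>"
      using \<epsilon> by (simp add: ln_div)
    also have "exp \<dots> \<le> (1 - real t / real k) * exp 0 + real t / real k * exp (ln \<epsilon>)"
      using x convex_onD[OF exp_convex, of "real t / real k" 0 "ln \<epsilon>"] by simp
    also have "\<dots> = 1 - real t / real k * (1 - \<epsilon>)"
      using \<epsilon> by (simp add: right_diff_distrib)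
    finally show ?thesis
      unfolding m_def by (simp add: mult_left_mono)
  qed
qed

text \<open>A sample that meets \<open>T\<close> is worth at least the average of \<open>g\<close>
  over \<open>S \<inter> T\<close>. By symmetry all elements of \<open>T\<close> have equal shares
  in these averages, so the expectation is at least the probability of meeting \<open>T\<close>
  times the average of \<open>g\<close> over \<open>T\<close>.\<close>

lemma sample_max_ge:
  fixes g :: "'a \<Rightarrow> real" and h :: "'a set \<Rightarrow> real"
  assumes fin: "finite V" and k: "0 < k" and \<epsilon>: "0 < \<epsilon>" "\<epsilon> < 1"
    and T: "T \<subseteq> V" "card T \<le> k"
    and g: "\<And>e. e \<in> V \<Longrightarrow> 0 \<le> g e" and h: "\<And>S e. S \<subseteq> V \<Longrightarrow> e \<in> S \<Longrightarrow> g e \<le> h S"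
    and h0: "\<And>S. 0 \<le> h S"
  shows "(1 - \<epsilon>) / real k * (\<Sum>e\<in>T. g e)
    \<le> measure_pmf.expectation (pmf_of_set {S. S \<subseteq> V \<and> card S = sample_size V k \<epsilon>}) h"
proof -
  define s where "s = sample_size V k \<epsilon>"
  define X where "X = {S. S \<subseteq> V \<and> card S = s}"
  have s: "s \<le> card V" by (simp add: s_def sample_size_def)
  have finX: "finite X"
    by (rule finite_subset[of _ "Pow V"]) (auto simp: X_def fin)
  have cardX: "card X = card V choose s"
    unfolding X_def using n_subsets[OF fin] .
  have Xne: "X \<noteq> {}"
    using cardX s finX by (auto simp: card_eq_0_iff binomial_eq_0_iff)
  have finT: "finite T" using T(1) fin by (rule finite_subset)
  have E: "measure_pmf.expectation (pmf_of_set X) h = (\<Sum>S\<in>X. h S) / card X"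
    using Xne finX by (rule integral_pmf_of_set)
  show ?thesis
  proof (cases "T = {}")
    case True
    thus ?thesis
      using h0 by (auto intro: expectation_nonneg_pmf)
  next
    case False
    define t where "t = card T"
    have t: "0 < t" "t \<le> card V" "t \<le> k"
      using False finT T card_mono[OF fin] by (auto simp: t_def card_gt_0_iff)
    \<comment> \<open>Up to the factor \<open>card X\<close>, the expected share of \<open>e\<close>
      in the average over \<open>S \<inter> T\<close>.\<close>
    define w where "w e = (\<Sum>S\<in>{S\<in>X. e \<in> S}. 1 / real (card (S \<inter> T)))" for e
    have w_eq: "w e = w e'" if "e \<in> T" "e' \<in> T" for e e'
    proof -
      \<comment> \<open>Exchanging \<open>e\<close> and \<open>e'\<close> maps \<open>V\<close> and
        \<open>T\<close> to themselves, so it permutes the samples and preserves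
        \<open>card (S \<inter> T)\<close>.\<close>
      let ?\<tau> = "Transposition.transpose e e'"
      have \<tau>V: "?\<tau> ` V = V" and \<tau>T: "?\<tau> ` T = T"
        using that T(1) by (auto simp: subset_iff intro!: transpose_image_eq)
      have inX: "?\<tau> ` S \<in> X" if "S \<in> X" for S
        using that \<tau>V unfolding X_def
        by (auto simp: card_image inj_on_transpose)
      have inv: "?\<tau> ` ?\<tau> ` S = S" for S
        by (simp add: image_comp)
      have bij: "bij_betw ((`) ?\<tau>) {S\<in>X. e \<in> S} {S\<in>X. e' \<in> S}"
      proof (rule bij_betwI[where g="(`) ?\<tau>"])
        show "(`) ?\<tau> \<in> {S\<in>X. e \<in> S} \<rightarrow> {S\<in>X. e' \<in> S}"
          using inX by (auto intro: image_eqI[of _ _ e])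
        show "(`) ?\<tau> \<in> {S\<in>X. e' \<in> S} \<rightarrow> {S\<in>X. e \<in> S}"
          using inX by (auto intro: image_eqI[of _ _ e'])
      qed (simp_all add: inv)
      have card_eq: "card (?\<tau> ` S \<inter> T) = card (S \<inter> T)" for S
      proof -
        have "?\<tau> ` S \<inter> T = ?\<tau> ` (S \<inter> T)"
          using \<tau>T by (metis image_Int inj_on_transpose)
        thus ?thesis
          by (simp add: card_image inj_on_transpose)
      qed
      have "w e' = (\<Sum>S\<in>{S\<in>X. e \<in> S}. 1 / real (card (?\<tau> ` S \<inter> T)))"
        unfolding w_def by (rule sum.reindex_bij_betw[OF bij, symmetric])
      thus ?thesis
        by (simp add: card_eq w_def)
    qed
    \<comment> \<open>Double counting, wanted for two functions: the constant 1 gives the total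
      weight, and \<open>g\<close> gives the estimate.\<close>
    have swap: "(\<Sum>e\<in>T. g' e * w e) = (\<Sum>S\<in>X. (\<Sum>e\<in>S \<inter> T. g' e) / real (card (S \<inter> T)))" for g' :: "'a \<Rightarrow> real"
    proof -
      have "(\<Sum>e\<in>T. g' e * w e) = (\<Sum>e\<in>T. \<Sum>S\<in>X. if e \<in> S then g' e / real (card (S \<inter> T)) else 0)"
        unfolding w_def using finX
        by (intro sum.cong refl)
          (simp add: sum_distrib_left sum.inter_filter if_distrib[of "(*) _"] cong: if_cong)
      also have "\<dots> = (\<Sum>S\<in>X. \<Sum>e\<in>T. if e \<in> S then g' e / real (card (S \<inter> T)) else 0)"
        by (rule sum.swap)
      also have "\<dots> = (\<Sum>S\<in>X. (\<Sum>e\<in>S \<inter> T. g' e) / real (card (S \<inter> T)))"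
        using finT by (intro sum.cong refl)
          (simp add: sum_divide_distrib Int_commute flip: sum.inter_restrict)
      finally show ?thesis .
    qed
    obtain e0 where e0: "e0 \<in> T" using False by blast
    have "real t * w e0 = (\<Sum>e\<in>T. 1 * w e)"
    proof -
      have "(\<Sum>e\<in>T. w e) = (\<Sum>e\<in>T. w e0)"
        using w_eq[OF _ e0] by (intro sum.cong) auto
      thus ?thesis by (simp add: t_def)
    qed
    also have "\<dots> = (\<Sum>S\<in>X. real (card (S \<inter> T)) / real (card (S \<inter> T)))"
      unfolding swap by simp
    \<comment> \<open>Division by zero yields 0 for a sample that misses \<open>T\<close>, so the
      sum counts exactly the samples that meet it.\<close>
    also have "\<dots> = (\<Sum>S\<in>X. 1 - of_bool (S \<inter> T = {}))"
      using finT by (intro sum.cong) auto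
    also have "\<dots> = real (card X) - real (card {S\<in>X. S \<inter> T = {}})"
      using finX by (simp add: sum_subtractf Int_def)
    also have "{S\<in>X. S \<inter> T = {}} = {S. S \<subseteq> V - T \<and> card S = s}"
      unfolding X_def by blast
    also have "card \<dots> = (card V - t) choose s"
      using n_subsets[of "V - T" s] fin T(1) finT by (simp add: card_Diff_subset t_def)
    also have "real (card X) - real ((card V - t) choose s)
        \<ge> real (card X) - real (card V choose s) * (1 - real t / real k * (1 - \<epsilon>))"
      using sample_avoids_le[OF fin k \<epsilon> t] unfolding s_def by (rule diff_left_mono)
    finally have "real t * w e0 \<ge> real t * (real (card X) * (1 - \<epsilon>) / real k)"
      unfolding cardX by (simp add: algebra_simps)
    hence w_ge: "w e0 \<ge> real (card X) * (1 - \<epsilon>) / real k"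
      by (rule mult_left_le_imp_le) (use t(1) in simp)
    have "real (card X) * ((1 - \<epsilon>) / real k * (\<Sum>e\<in>T. g e)) = (\<Sum>e\<in>T. g e) * (real (card X) * (1 - \<epsilon>) / real k)"
      by simp
    also have "\<dots> \<le> (\<Sum>e\<in>T. g e) * w e0"
      using w_ge g T(1) by (intro mult_left_mono sum_nonneg) auto
    also have "\<dots> = (\<Sum>e\<in>T. g e * w e)"
      unfolding sum_distrib_right using w_eq[OF e0] by (intro sum.cong) auto
    also have "\<dots> \<le> (\<Sum>S\<in>X. h S)"
      unfolding swap
    proof (rule sum_mono)
      fix S assume S: "S \<in> X"
      have "(\<Sum>e\<in>S \<inter> T. g e) \<le> real (card (S \<inter> T)) * h S"
        using S h unfolding X_def by (intro sum_bounded_above) auto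
      thus "(\<Sum>e\<in>S \<inter> T. g e) / real (card (S \<inter> T)) \<le> h S"
        using h0[of S] by (cases "card (S \<inter> T) = 0") (auto simp: divide_le_eq mult.commute)
    qed
    finally have "(1 - \<epsilon>) / real k * (\<Sum>e\<in>T. g e) \<le> (\<Sum>S\<in>X. h S) / card X"
      using finX Xne by (simp add: le_divide_eq card_gt_0_iff mult.commute)
    thus ?thesis
      using E unfolding X_def s_def by simp
  qed
qed

section \<open>Unfolding the queries, and the rate of the greedy steps\<close>

lemma policy_of_query_all:
  "policy_of orc (query_all es \<psi> v k) =
    policy_of orc (k (\<lambda>e. if e \<in> set es then orc e \<psi> else v e))"
proof (induction es arbitrary: v)
  case (Cons a es)
  have "(\<lambda>e. if e \<in> set es then orc e \<psi> else (v(a := orc a \<psi>)) e)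
      = (\<lambda>e. if e \<in> set (a # es) then orc e \<psi> else v e)"
    by auto
  with Cons.IH[of "v(a := orc a \<psi>)"] show ?case
    by (simp only: query_all.simps policy_of.simps)
qed simp

lemma set_some_enumeration:
  assumes "finite S"
  shows "set (SOME es. set es = S \<and> distinct es) = S" "distinct (SOME es. set es = S \<and> distinct es)"
proof -
  have "\<exists>es. set es = S \<and> distinct es"
    using finite_distinct_list[OF assms] .
  from someI_ex[OF this]
  show "set (SOME es. set es = S \<and> distinct es) = S" "distinct (SOME es. set es = S \<and> distinct es)"
    by blast+
qed

lemma samples:
  fixes \<epsilon> :: real and k :: nat
  assumes "finite V"
  defines "X \<equiv> {S. S \<subseteq> V \<and> card S = sample_size V k \<epsilon>}"
  shows "finite X" "X \<noteq> {}"
proof -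
  show "finite X"
    by (rule finite_subset[of _ "Pow V"]) (auto simp: X_def assms)
  have "sample_size V k \<epsilon> \<le> card V" by (simp add: sample_size_def)
  from obtain_subset_with_card_n[OF this] obtain S where "S \<subseteq> V" "card S = sample_size V k \<epsilon>"
    by metis
  thus "X \<noteq> {}" by (auto simp: X_def)
qed

text \<open>The origin of \<alpha>: the power is at most \<open>exp (- (1 - \<epsilon>))\<close>,
  and the chord of the exponential from -1 to 0 bounds this by
  \<open>(1 - \<epsilon>) / exp 1 + \<epsilon>\<close>.\<close>

lemma greedy_rate_ge:
  fixes \<epsilon> :: real
  assumes "0 < \<epsilon>" "\<epsilon> < 1" "0 < k"
  shows "1 - 1 / exp 1 - \<epsilon> \<le> 1 - (1 - (1 - \<epsilon>) / real k) ^ k"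
proof -
  have "(1 - \<epsilon>) / real k \<le> 1"
    using assms by (simp add: divide_le_eq)
  hence "(1 - (1 - \<epsilon>) / real k) ^ k \<le> exp (- ((1 - \<epsilon>) / real k)) ^ k"
    using exp_ge_add_one_self[of "- ((1 - \<epsilon>) / real k)"] by (intro power_mono) auto
  also have "\<dots> = exp (real k * (- ((1 - \<epsilon>) / real k)))"
    by (rule exp_of_nat_mult[symmetric])
  also have "real k * (- ((1 - \<epsilon>) / real k)) = (1 - \<epsilon>) * (- 1) + \<epsilon> * 0"
    using assms by simp
  also have "exp \<dots> \<le> (1 - \<epsilon>) * exp (- 1) + \<epsilon> * exp 0"
    using assms convex_onD[OF exp_convex, of \<epsilon> "- 1" 0] by simp
  also have "\<dots> \<le> 1 / exp 1 + \<epsilon>"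
    using assms by (simp add: exp_minus field_simps)
  finally show ?thesis by simp
qed

lemma selected_Toss_sample:
  assumes "S \<in> set_pmf (selected (Toss (map_pmf h (pmf_of_set Y))) \<phi>)" "finite Y" "Y \<noteq> {}"
  obtains X where "X \<in> Y" "S \<in> set_pmf (selected (h X) \<phi>)"
proof -
  have "S \<in> (\<Union>X\<in>Y. set_pmf (selected (h X) \<phi>))"
    using assms by simp
  thus ?thesis
    using that by blast
qed

section \<open>Analysis of the greedy policy\<close>

locale greedy_run = adaptive_utility E Os p f
  for E :: "'e set" and Os :: "'o set" and p f +
  fixes B :: "nat \<Rightarrow> 'e set" and d :: "nat \<Rightarrow> nat" and \<epsilon> :: real
    and tie :: "('e, 'o) tie_rule" and I :: "nat set"
  assumes B_subset: "\<And>i. i \<in> I \<Longrightarrow> B i \<subseteq> E"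
    and eps_pos: "0 < \<epsilon>" and eps_less_1: "\<epsilon> < 1"
    and tie: "argmax_rule tie"
begin

abbreviation samples :: "nat \<Rightarrow> 'e set set" where
  "samples i \<equiv> {S. S \<subseteq> B i \<and> card S = sample_size (B i) (d i) \<epsilon>}"

text \<open>The tie rule may depend on the whole valuation, so this must be the one that
  \<open>query_all\<close> hands over: oracle answers on the sample and the initial value 0
  elsewhere.\<close>

definition pick :: "nat \<Rightarrow> nat \<Rightarrow> ('e \<rightharpoonup> 'o) \<Rightarrow> 'e set \<Rightarrow> 'e" where
  "pick i j \<psi> S = tie i j \<psi> S (\<lambda>e. if e \<in> S then item_gain p f e \<psi> else 0)"

definition greedy_policy :: "(nat \<times> nat) list \<Rightarrow> ('e \<rightharpoonup> 'o) \<Rightarrow> ('e, 'o) policy" where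
  "greedy_policy L \<psi> = policy_of (item_gain p f) (gasg_steps B d \<epsilon> tie L \<psi>)"

definition greedy_val :: "(nat \<times> nat) list \<Rightarrow> ('e \<rightharpoonup> 'o) \<Rightarrow> real" where
  "greedy_val L \<psi> = val (greedy_policy L \<psi>) \<psi>"

definition greedy_gain :: "(nat \<times> nat) list \<Rightarrow> ('e \<rightharpoonup> 'o) \<Rightarrow> real" where
  "greedy_gain L \<psi> = greedy_val L \<psi> - val Stop \<psi>"

lemma finite_B: "i \<in> I \<Longrightarrow> finite (B i)"
  using B_subset finite_E by (blast intro: finite_subset)

lemma pick:
  assumes "finite S" "S \<noteq> {}"
  shows "pick i j \<psi> S \<in> S" "e \<in> S \<Longrightarrow> item_gain p f e \<psi> \<le> item_gain p f (pick i j \<psi> S) \<psi>"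
proof -
  let ?v = "\<lambda>e. if e \<in> S then item_gain p f e \<psi> else 0"
  have *: "is_arg_max ?v (\<lambda>e. e \<in> S) (pick i j \<psi> S)"
    using tie assms unfolding argmax_rule_def pick_def by blast
  thus "pick i j \<psi> S \<in> S"
    by (simp add: is_arg_max_def)
  with * show "item_gain p f e \<psi> \<le> item_gain p f (pick i j \<psi> S) \<psi>" if "e \<in> S"
    using that by (auto simp: is_arg_max_def not_less)
qed

lemma greedy_policy_Cons:
  assumes "i \<in> I"
  shows "greedy_policy ((i, j) # L) \<psi> = Toss (map_pmf
    (\<lambda>S. if S = {} then greedy_policy L \<psi>
         else Select (pick i j \<psi> S) (\<lambda>s. greedy_policy L (\<psi>(pick i j \<psi> S \<mapsto> s))))
    (pmf_of_set (samples i)))"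
proof -
  have "finite S" if "S \<in> samples i" for S
    using that finite_B[OF assms] finite_subset by blast
  hence "set (SOME es. set es = S \<and> distinct es) = S" if "S \<in> samples i" for S
    using that set_some_enumeration by blast
  moreover have "set_pmf (pmf_of_set (samples i)) = samples i"
    using samples[OF finite_B[OF assms], of "d i" \<epsilon>] by (intro set_pmf_of_set)
  ultimately have "map_pmf (policy_of (item_gain p f)) (map_pmf (\<lambda>S. if S = {} then gasg_steps B d \<epsilon> tie L \<psi>
      else query_all (SOME es. set es = S \<and> distinct es) \<psi> (\<lambda>_. 0)
        (\<lambda>v. let e = tie i j \<psi> S v
             in ASelect e (\<lambda>s. gasg_steps B d \<epsilon> tie L (\<psi>(e \<mapsto> s))))) (pmf_of_set (samples i)))
    = map_pmf (\<lambda>S. if S = {} then greedy_policy L \<psi>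
         else Select (pick i j \<psi> S) (\<lambda>s. greedy_policy L (\<psi>(pick i j \<psi> S \<mapsto> s)))) (pmf_of_set (samples i))"
    unfolding pmf.map_comp
    by (intro map_pmf_cong refl)
       (simp add: policy_of_query_all Let_def pick_def greedy_policy_def del: fun_upd_apply)
  thus ?thesis
    by (simp add: greedy_policy_def)
qed

lemma integrable_samples:
  fixes h :: "'e set \<Rightarrow> real"
  assumes "i \<in> I"
  shows "integrable (measure_pmf (pmf_of_set (samples i))) h"
  using samples[OF finite_B[OF assms], of "d i" \<epsilon>]
  by (intro integrable_measure_pmf_finite) simp

lemma greedy_val_Cons:
  assumes \<psi>: "\<psi> \<in> PR" and i: "i \<in> I"
  shows "greedy_val ((i, j) # L) \<psi> = measure_pmf.expectation (pmf_of_set (samples i))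
    (\<lambda>S. if S = {} then greedy_val L \<psi> else after (pick i j \<psi> S) (greedy_val L) \<psi>)"
proof -
  have "val (if S = {} then greedy_policy L \<psi>
      else Select (pick i j \<psi> S) (\<lambda>s. greedy_policy L (\<psi>(pick i j \<psi> S \<mapsto> s)))) \<psi>
    = (if S = {} then greedy_val L \<psi> else after (pick i j \<psi> S) (greedy_val L) \<psi>)"
    if "S \<in> samples i" for S
  proof (cases "S = {}")
    case False
    have "pick i j \<psi> S \<in> E"
      using pick(1)[OF _ False, of i j \<psi>] that finite_B[OF i] B_subset[OF i] finite_subset by blast
    thus ?thesis
      using False by (simp add: val_Select[OF \<psi>] after_def greedy_val_def)
  qed (simp add: greedy_val_def)
  thus ?thesis
    using samples[OF finite_B[OF i], of "d i" \<epsilon>]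
    unfolding greedy_val_def[of "(i, j) # L"] greedy_policy_Cons[OF i] val_Toss[OF \<psi>] integral_map_pmf
    by (intro expectation_cong_pmf) simp
qed

lemma controlled_greedy_val: "controlled (greedy_val L)"
  by (rule controlledI[where c=1]) (simp add: greedy_val_def val_nonneg val_le_bound)

lemma controlled_greedy_gain: "controlled (greedy_gain L)"
  unfolding greedy_gain_def by (intro controlled_diff controlled_greedy_val controlled_val)

lemma greedy_gain_Cons:
  assumes \<psi>: "\<psi> \<in> PR" and i: "i \<in> I"
  shows "greedy_gain ((i, j) # L) \<psi> = measure_pmf.expectation (pmf_of_set (samples i))
    (\<lambda>S. if S = {} then greedy_gain L \<psi>
         else item_gain p f (pick i j \<psi> S) \<psi> + after (pick i j \<psi> S) (greedy_gain L) \<psi>)"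
proof -
  have X: "finite (samples i)" "samples i \<noteq> {}"
    using samples[OF finite_B[OF i]] .
  have "greedy_gain ((i, j) # L) \<psi> = measure_pmf.expectation (pmf_of_set (samples i))
    (\<lambda>S. (if S = {} then greedy_val L \<psi> else after (pick i j \<psi> S) (greedy_val L) \<psi>) - val Stop \<psi>)"
    unfolding greedy_gain_def greedy_val_Cons[OF assms]
    by (subst Bochner_Integration.integral_diff) (auto intro: integrable_samples i)
  also have "\<dots> = measure_pmf.expectation (pmf_of_set (samples i))
    (\<lambda>S. if S = {} then greedy_gain L \<psi>
         else item_gain p f (pick i j \<psi> S) \<psi> + after (pick i j \<psi> S) (greedy_gain L) \<psi>)"
  proof (rule expectation_cong_pmf)
    fix S assume "S \<in> set_pmf (pmf_of_set (samples i))"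
    hence S: "S \<subseteq> B i" using X by simp
    show "(if S = {} then greedy_val L \<psi> else after (pick i j \<psi> S) (greedy_val L) \<psi>) - val Stop \<psi>
      = (if S = {} then greedy_gain L \<psi>
         else item_gain p f (pick i j \<psi> S) \<psi> + after (pick i j \<psi> S) (greedy_gain L) \<psi>)"
    proof (cases "S = {}")
      case False
      have "finite S" using S finite_B[OF i] by (rule finite_subset)
      hence "pick i j \<psi> S \<in> E"
        using pick(1)[OF _ False, of i j \<psi>] S B_subset[OF i] by blast
      thus ?thesis
        using False
        by (simp add: greedy_gain_def[abs_def] after_diff[OF controlled_greedy_val controlled_val \<psi>]
            item_gain_eq[OF \<psi>])
    qed (simp add: greedy_gain_def)
  qed
  finally show ?thesis .
qed

text \<open>
  Selecting an item of gain \<open>g\<close> decreases \<open>Q\<close> by at most \<open>g\<close> in expectation, and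
  \<open>M = best (B i) (d i)\<close> by an amount in \<open>[0, g]\<close>. Of the \<open>(1 + \<alpha>) g\<close> gained, these losses consume at
  most \<open>(\<alpha> + max 0 (\<beta> - \<alpha>)) g \<le> (\<alpha> + \<beta>) g\<close>; the rest raises the coefficient of \<open>M\<close>, since the
  expected \<open>g\<close> is at least \<open>(1 - \<epsilon>) / d i\<close> times \<open>M\<close>.
\<close>
lemma greedy_step:
  assumes \<psi>: "\<psi> \<in> PR" and i: "i \<in> I" and di: "0 < d i"
    and \<alpha>: "0 \<le> \<alpha>" and \<beta>: "0 \<le> \<beta>" "\<beta> \<le> 1"
    and ctrl: "controlled Q"
    and Q: "\<And>\<psi> e. \<psi> \<in> PR \<Longrightarrow> e \<in> E \<Longrightarrow> Q \<psi> - item_gain p f e \<psi> \<le> after e Q \<psi>"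
    and IH: "\<And>\<psi>. \<psi> \<in> PR \<Longrightarrow>
      \<alpha> * Q \<psi> + (\<beta> - \<alpha>) * best (B i) (d i) \<psi> \<le> (1 + \<alpha>) * greedy_gain L \<psi>"
  shows "\<alpha> * Q \<psi> + (\<beta> + (1 - \<beta>) * ((1 - \<epsilon>) / real (d i)) - \<alpha>) * best (B i) (d i) \<psi>
    \<le> (1 + \<alpha>) * greedy_gain ((i, j) # L) \<psi>"
proof (cases "B i = {}")
  case True
  \<comment> \<open>In an empty group the step is void, and the change of coefficient is harmless
    since the best gain is 0.\<close>
  hence "samples i = {{}}"
    by (auto simp: sample_size_def)
  hence "greedy_gain ((i, j) # L) \<psi> = greedy_gain L \<psi>"
    unfolding greedy_gain_Cons[OF \<psi> i] by (simp add: pmf_of_set_singleton)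
  moreover have "best (B i) (d i) \<psi> = 0"
    using True by (intro best_eq_0 \<psi>) auto
  ultimately show ?thesis
    using IH[OF \<psi>] by simp
next
  case False
  let ?M = "best (B i) (d i)"
  let ?g = "\<lambda>e. item_gain p f e \<psi>"
  have fin: "finite (B i)" and BE: "B i \<subseteq> E"
    using finite_B B_subset i by blast+
  have X: "finite (samples i)" "samples i \<noteq> {}"
    using samples[OF fin] .
  have "0 < real (card (B i)) / real (d i) * ln (1 / \<epsilon>)"
    using False fin di eps_pos eps_less_1 by (simp add: card_gt_0_iff)
  hence "0 < sample_size (B i) (d i) \<epsilon>"
    using False fin unfolding sample_size_def by (simp add: card_gt_0_iff)
  hence ne: "S \<noteq> {}" if "S \<in> samples i" for S
    using that by auto
  \<comment> \<open>The value 0 away from the nonempty subsets of \<open>B i\<close> makes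
    \<open>h\<close> nonnegative on all sets, as \<open>sample_max_ge\<close> demands; nothing is
    known about \<open>pick\<close> there.\<close>
  define h where "h S = (if S = {} \<or> \<not> S \<subseteq> B i then 0 else ?g (pick i j \<psi> S))" for S
  have pick_B: "pick i j \<psi> S \<in> B i" if "S \<noteq> {}" "S \<subseteq> B i" for S
    using pick(1)[OF finite_subset[OF that(2) fin] that(1)] that(2) by blast
  obtain T where T: "T \<subseteq> B i" "card T \<le> d i" "?M \<psi> \<le> (\<Sum>e\<in>T. ?g e)"
    using best_le_sum_item_gain[OF \<psi> BE] by blast
  have "(1 - \<epsilon>) / real (d i) * (\<Sum>e\<in>T. ?g e) \<le> measure_pmf.expectation (pmf_of_set (samples i)) h"
  proof (rule sample_max_ge[OF fin di eps_pos eps_less_1 T(1,2)])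
    show "0 \<le> ?g e" if "e \<in> B i" for e
      using that BE by (intro item_gain_nonneg[OF \<psi>]) auto
    show "?g e \<le> h S" if "S \<subseteq> B i" "e \<in> S" for S e
      using pick(2)[OF finite_subset[OF that(1) fin] _ that(2)] that unfolding h_def by auto
    show "0 \<le> h S" for S
      using pick_B[of S] BE unfolding h_def by (auto intro: item_gain_nonneg[OF \<psi>])
  qed
  moreover have "(1 - \<epsilon>) / real (d i) * ?M \<psi> \<le> (1 - \<epsilon>) / real (d i) * (\<Sum>e\<in>T. ?g e)"
    using T(3) eps_less_1 by (intro mult_left_mono) auto
  ultimately have "(1 - \<epsilon>) / real (d i) * ?M \<psi> \<le> measure_pmf.expectation (pmf_of_set (samples i)) h"
    by linarith
  hence "(1 - \<beta>) * ((1 - \<epsilon>) / real (d i) * ?M \<psi>)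
      \<le> (1 - \<beta>) * measure_pmf.expectation (pmf_of_set (samples i)) h"
    using \<beta> by (intro mult_left_mono) auto
  hence "\<alpha> * Q \<psi> + (\<beta> + (1 - \<beta>) * ((1 - \<epsilon>) / real (d i)) - \<alpha>) * ?M \<psi>
    \<le> \<alpha> * Q \<psi> + (\<beta> - \<alpha>) * ?M \<psi> + (1 - \<beta>) * measure_pmf.expectation (pmf_of_set (samples i)) h"
    by (simp add: algebra_simps)
  also have "\<dots> = measure_pmf.expectation (pmf_of_set (samples i))
      (\<lambda>S. \<alpha> * Q \<psi> + (\<beta> - \<alpha>) * ?M \<psi> + (1 - \<beta>) * h S)"
    by (subst Bochner_Integration.integral_add) (auto intro: integrable_samples i)
  also have "\<dots> \<le> measure_pmf.expectation (pmf_of_set (samples i))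
      (\<lambda>S. (1 + \<alpha>) * (if S = {} then greedy_gain L \<psi>
         else ?g (pick i j \<psi> S) + after (pick i j \<psi> S) (greedy_gain L) \<psi>))"
  proof (rule expectation_mono_pmf)
    fix S assume "S \<in> set_pmf (pmf_of_set (samples i))"
    hence "S \<in> samples i" using X by simp
    hence S: "S \<subseteq> B i" "S \<noteq> {}" using ne by auto
    define e where "e = pick i j \<psi> S"
    have e: "e \<in> E"
      using pick_B[OF S(2,1)] BE by (auto simp: e_def)
    have ctrlM: "controlled ?M"
      by (rule controlled_best[OF BE])
    have "\<alpha> * after e Q \<psi> + (\<beta> - \<alpha>) * after e ?M \<psi>
        = after e (\<lambda>\<psi>. \<alpha> * Q \<psi> + (\<beta> - \<alpha>) * ?M \<psi>) \<psi>"
      unfolding after_cmult[symmetric]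
      by (intro after_add[symmetric] controlled_cmult ctrl ctrlM \<psi> e)
    also have "\<dots> \<le> after e (\<lambda>\<psi>. (1 + \<alpha>) * greedy_gain L \<psi>) \<psi>"
      by (intro after_mono controlled_add controlled_cmult ctrl ctrlM controlled_greedy_gain \<psi> e
          IH upd_PR)
    finally have "\<alpha> * after e Q \<psi> + (\<beta> - \<alpha>) * after e ?M \<psi> \<le> (1 + \<alpha>) * after e (greedy_gain L) \<psi>"
      unfolding after_cmult .
    moreover have "\<alpha> * (Q \<psi> - ?g e) \<le> \<alpha> * after e Q \<psi>"
      using Q[OF \<psi> e] \<alpha> by (rule mult_left_mono)
    moreover have "(\<beta> - \<alpha>) * ?M \<psi> - \<beta> * ?g e \<le> (\<beta> - \<alpha>) * after e ?M \<psi>"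
    \<comment> \<open>The sign of the coefficient decides which bound on the expected decrease of
      \<open>?M\<close> is the relevant one: at most the gain, or at least 0.\<close>
    proof (cases "\<alpha> \<le> \<beta>")
      case True
      have "(\<beta> - \<alpha>) * (?M \<psi> - ?g e) \<le> (\<beta> - \<alpha>) * after e ?M \<psi>"
        using best_le_after[OF \<psi> e BE, of "d i"] True by (intro mult_left_mono) auto
      moreover have "0 \<le> \<alpha> * ?g e"
        using \<alpha> item_gain_nonneg[OF \<psi> e] by simp
      ultimately show ?thesis
        by (simp add: algebra_simps)
    next
      case False
      have "(\<beta> - \<alpha>) * ?M \<psi> \<le> (\<beta> - \<alpha>) * after e ?M \<psi>"
        using best_upd_le[OF \<psi> e BE, of "d i"] False by (intro mult_left_mono_neg) auto
      moreover have "0 \<le> \<beta> * ?g e"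
        using \<beta> item_gain_nonneg[OF \<psi> e] by simp
      ultimately show ?thesis by simp
    qed
    ultimately have "\<alpha> * Q \<psi> + (\<beta> - \<alpha>) * ?M \<psi> + (1 - \<beta>) * ?g e
        \<le> (1 + \<alpha>) * (?g e + after e (greedy_gain L) \<psi>)"
      by (simp add: algebra_simps)
    thus "\<alpha> * Q \<psi> + (\<beta> - \<alpha>) * ?M \<psi> + (1 - \<beta>) * h S \<le> (1 + \<alpha>) * (if S = {} then greedy_gain L \<psi>
         else ?g (pick i j \<psi> S) + after (pick i j \<psi> S) (greedy_gain L) \<psi>)"
      using S by (simp add: h_def e_def)
  qed (rule integrable_samples[OF i])+
  also have "\<dots> = (1 + \<alpha>) * greedy_gain ((i, j) # L) \<psi>"
    unfolding greedy_gain_Cons[OF \<psi> i] by simp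
  finally show ?thesis .
qed

text \<open>Starting from 0, the recursion of \<open>greedy_step\<close> for the coefficient
  \<open>\<beta>\<close> is solved by \<open>1 - (1 - q) ^ n\<close>. The claim without the term of
  the group is reached only at the full length \<open>d i\<close>, where
  \<open>greedy_rate_ge\<close> makes the coefficient nonnegative; the induction therefore runs over
  lists of any length with the term kept.\<close>

lemma greedy_group:
  assumes \<psi>: "\<psi> \<in> PR" and i: "i \<in> I" and js: "length js = d i"
    and \<alpha>: "0 \<le> \<alpha>" "\<alpha> \<le> 1 - 1 / exp 1 - \<epsilon>"
    and ctrl: "controlled Q"
    and Q: "\<And>\<psi> e. \<psi> \<in> PR \<Longrightarrow> e \<in> E \<Longrightarrow> Q \<psi> - item_gain p f e \<psi> \<le> after e Q \<psi>"
    and IH: "\<And>\<psi>. \<psi> \<in> PR \<Longrightarrow> \<alpha> * (Q \<psi> - best (B i) (d i) \<psi>) \<le> (1 + \<alpha>) * greedy_gain L \<psi>"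
  shows "\<alpha> * Q \<psi> \<le> (1 + \<alpha>) * greedy_gain (map (Pair i) js @ L) \<psi>"
proof (cases "d i = 0")
  case True
  thus ?thesis
    using IH[OF \<psi>] js best_eq_0[OF \<psi> B_subset[OF i]] by simp
next
  case False
  define q where "q = (1 - \<epsilon>) / real (d i)"
  have q: "0 \<le> q" "q \<le> 1"
    using False eps_pos eps_less_1 by (auto simp: q_def divide_le_eq)
  have *: "\<psi> \<in> PR \<Longrightarrow> \<alpha> * Q \<psi> + (1 - (1 - q) ^ length js - \<alpha>) * best (B i) (d i) \<psi>
      \<le> (1 + \<alpha>) * greedy_gain (map (Pair i) js @ L) \<psi>" for js \<psi>
  proof (induction js arbitrary: \<psi>)
    case Nil
    thus ?case using IH[OF Nil] by (simp add: algebra_simps)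
  next
    case (Cons j js)
    have "\<alpha> * Q \<psi> + ((1 - (1 - q) ^ length js) + (1 - (1 - (1 - q) ^ length js)) * q - \<alpha>) * best (B i) (d i) \<psi>
      \<le> (1 + \<alpha>) * greedy_gain ((i, j) # map (Pair i) js @ L) \<psi>"
      unfolding q_def
      by (rule greedy_step)
         (use q Cons i False \<alpha> ctrl Q in \<open>auto simp flip: q_def simp: power_le_one\<close>)
    also have "(1 - (1 - q) ^ length js) + (1 - (1 - (1 - q) ^ length js)) * q = 1 - (1 - q) ^ length (j # js)"
      by (simp add: algebra_simps)
    finally show ?case by simp
  qed
  have "\<alpha> \<le> 1 - (1 - q) ^ length js"
    using greedy_rate_ge[OF eps_pos eps_less_1, of "d i"] False \<alpha>(2) unfolding js q_def by linarith
  hence "0 \<le> (1 - (1 - q) ^ length js - \<alpha>) * best (B i) (d i) \<psi>"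
    using best_nonneg[OF \<psi> B_subset[OF i]] by simp
  thus ?thesis
    using *[OF \<psi>, of js] by linarith
qed

text \<open>\<open>Q\<close> must be general, because peeling off group \<open>i\<close> replaces it
  by \<open>Q - best (B i) (d i)\<close>. This difference again loses at most the gain of an item,
  as the subtracted term does not increase in expectation. When no group is left, \<open>Q\<close>
  is at most 0.\<close>

lemma greedy_gain_ge:
  assumes \<alpha>: "0 \<le> \<alpha>" "\<alpha> \<le> 1 - 1 / exp 1 - \<epsilon>"
  shows "\<psi> \<in> PR \<Longrightarrow> set is \<subseteq> I \<Longrightarrow> controlled Q \<Longrightarrow>
    (\<And>\<psi> e. \<psi> \<in> PR \<Longrightarrow> e \<in> E \<Longrightarrow> Q \<psi> - item_gain p f e \<psi> \<le> after e Q \<psi>) \<Longrightarrow>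
    (\<And>\<psi>. \<psi> \<in> PR \<Longrightarrow> Q \<psi> \<le> (\<Sum>i\<leftarrow>is. best (B i) (d i) \<psi>)) \<Longrightarrow>
    \<alpha> * Q \<psi> \<le> (1 + \<alpha>) * greedy_gain [(i, j). i \<leftarrow> is, j \<leftarrow> [1..<Suc (d i)]] \<psi>"
proof (induction "is" arbitrary: Q \<psi>)
  case Nil
  have "greedy_gain [] \<psi> = 0"
    by (simp add: greedy_gain_def greedy_val_def greedy_policy_def)
  thus ?case
    using Nil.prems(5)[OF Nil.prems(1)] \<alpha> by (simp add: mult_nonneg_nonpos)
next
  case (Cons i "is")
  let ?M = "best (B i) (d i)"
  have i: "i \<in> I" using Cons.prems by simp
  have ctrlM: "controlled ?M"
    by (rule controlled_best[OF B_subset[OF i]])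
  have "\<alpha> * Q \<psi> \<le> (1 + \<alpha>) * greedy_gain (map (Pair i) [1..<Suc (d i)] @
      [(i, j). i \<leftarrow> is, j \<leftarrow> [1..<Suc (d i)]]) \<psi>"
  proof (rule greedy_group[OF Cons.prems(1) i _ \<alpha> Cons.prems(3) Cons.prems(4)])
    fix \<psi> assume \<psi>: "\<psi> \<in> PR"
    show "\<alpha> * (Q \<psi> - ?M \<psi>) \<le> (1 + \<alpha>) * greedy_gain [(i, j). i \<leftarrow> is, j \<leftarrow> [1..<Suc (d i)]] \<psi>"
    proof (rule Cons.IH[OF \<psi>])
      show "controlled (\<lambda>\<psi>. Q \<psi> - ?M \<psi>)"
        by (intro controlled_diff Cons.prems ctrlM)
      show "Q \<psi> - ?M \<psi> - item_gain p f e \<psi> \<le> after e (\<lambda>\<psi>. Q \<psi> - ?M \<psi>) \<psi>"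
        if "\<psi> \<in> PR" "e \<in> E" for \<psi> e
        using Cons.prems(4)[OF that] best_upd_le[OF that B_subset[OF i], of "d i"]
          after_diff[OF Cons.prems(3) ctrlM that] by linarith
      show "Q \<psi> - ?M \<psi> \<le> (\<Sum>i\<leftarrow>is. best (B i) (d i) \<psi>)" if "\<psi> \<in> PR" for \<psi>
        using Cons.prems(5)[OF that] by simp
    qed (use Cons.prems in simp)
  qed simp_all
  thus ?case
    by simp
qed

lemma selected_greedy:
  assumes "set (map fst L) \<subseteq> I" "S \<in> set_pmf (selected (greedy_policy L \<psi>) \<phi>)"
  shows "S \<subseteq> E"
  using assms
proof (induction L arbitrary: S \<psi>)
  case Nil
  thus ?case by (simp add: greedy_policy_def)
next
  case (Cons ij L)
  obtain i j where ij: "ij = (i, j)" by force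
  have i: "i \<in> I" and L: "set (map fst L) \<subseteq> I"
    using Cons.prems(1) ij by auto
  obtain X where "X \<in> samples i"
    and S: "S \<in> set_pmf (selected (if X = {} then greedy_policy L \<psi>
       else Select (pick i j \<psi> X) (\<lambda>s. greedy_policy L (\<psi>(pick i j \<psi> X \<mapsto> s)))) \<phi>)"
    using Cons.prems(2) samples[OF finite_B[OF i]]
    unfolding ij greedy_policy_Cons[OF i] by (rule selected_Toss_sample)
  hence X: "X \<subseteq> B i" by simp
  show ?case
  proof (cases "X = {}")
    case True
    with S have "S \<in> set_pmf (selected (greedy_policy L \<psi>) \<phi>)"
      by (simp only: simp_thms if_True)
    thus ?thesis by (rule Cons.IH[OF L])
  next
    case False
    have "pick i j \<psi> X \<in> E"
      using pick(1)[OF finite_subset[OF X finite_B[OF i]] False] X B_subset[OF i] by blast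
    moreover from S False have "S \<in> insert (pick i j \<psi> X) `
        set_pmf (selected (greedy_policy L (\<psi>(pick i j \<psi> X \<mapsto> \<phi> (pick i j \<psi> X)))) \<phi>)"
      by (simp only: if_False selected.simps set_map_pmf)
    then obtain S' s where "S = insert (pick i j \<psi> X) S'"
      "S' \<in> set_pmf (selected (greedy_policy L (\<psi>(pick i j \<psi> X \<mapsto> s))) \<phi>)"
      by blast
    ultimately show ?thesis
      using Cons.IH[OF L, of S'] by simp
  qed
qed

lemma gasg_ratio:
  assumes I: "I = {1..b}" and disj: "disjoint_family_on B {1..b}"
    and feasible: "\<pi> \<in> feasible_policies E Os b B d"
  shows "(1 - 1 / exp 1 - \<epsilon>) / (4 - 2 / exp 1 - 2 * \<epsilon>) * f_avg p f \<pi>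
    \<le> f_avg p f (policy_of (item_gain p f) (gasg b B d \<epsilon> tie))"
proof -
  define \<alpha> where "\<alpha> = 1 - 1 / exp 1 - \<epsilon>"
  define L where "L = [(i, j). i \<leftarrow> [1..<Suc b], j \<leftarrow> [1..<Suc (d i)]]"
  have exp1: "1 / exp 1 < (1::real)" by simp
  have \<alpha>1: "0 < 1 + \<alpha>"
    using exp1 eps_less_1 unfolding \<alpha>_def by linarith
  have sel: "S \<subseteq> (\<Union>i\<in>I. B i) \<and> (\<forall>i\<in>I. card (S \<inter> B i) \<le> d i)"
    if "\<phi> \<in> set_pmf p" "S \<in> set_pmf (selected \<pi> \<phi>)" for \<phi> S
    using feasible that prior unfolding feasible_policies_def I by blast
  have "S \<subseteq> E" if "\<phi> \<in> set_pmf p" "S \<in> set_pmf (selected \<pi> \<phi>)" for \<phi> S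
    using sel[OF that] B_subset by blast
  hence opt: "f_avg p f \<pi> = val \<pi> Map.empty"
    by (rule f_avg_eq_val)
  have "set (map fst L) \<subseteq> I"
    by (auto simp: L_def I)
  hence "f_avg p f (greedy_policy L Map.empty) = val (greedy_policy L Map.empty) Map.empty"
    using selected_greedy by (intro f_avg_eq_val)
  hence greedy: "f_avg p f (policy_of (item_gain p f) (gasg b B d \<epsilon> tie)) = greedy_val L Map.empty"
    by (simp add: greedy_val_def greedy_policy_def gasg_def L_def)
  have nonneg: "0 \<le> greedy_val L Map.empty" "0 \<le> val \<pi> Map.empty" "0 \<le> val Stop Map.empty"
    by (simp_all add: greedy_val_def val_nonneg empty_PR)
  have ratio: "(1 - 1 / exp 1 - \<epsilon>) / (4 - 2 / exp 1 - 2 * \<epsilon>) = \<alpha> / (2 * (1 + \<alpha>))"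
    by (simp add: \<alpha>_def algebra_simps)
  have "\<alpha> / (2 * (1 + \<alpha>)) * val \<pi> Map.empty \<le> greedy_val L Map.empty"
  proof (cases "0 \<le> \<alpha>")
    case False
    \<comment> \<open>For \<open>\<epsilon>\<close> above \<open>1 - 1 / exp 1\<close> the ratio is
      negative and nonnegativity of the two values suffices; \<open>1 + \<alpha>\<close> stays
      positive because \<open>\<epsilon> < 1\<close>.\<close>
    hence "\<alpha> / (2 * (1 + \<alpha>)) * val \<pi> Map.empty \<le> 0"
      using \<alpha>1 nonneg(2) by (intro mult_nonpos_nonneg divide_nonpos_pos) auto
    thus ?thesis using nonneg(1) by linarith
  next
    case True
    have "\<alpha> * (val \<pi> Map.empty - val Stop Map.empty) \<le> (1 + \<alpha>) * greedy_gain L Map.empty"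
      unfolding L_def
    proof (rule greedy_gain_ge[where Q="\<lambda>\<psi>. val \<pi> \<psi> - val Stop \<psi>"])
      show "controlled (\<lambda>\<psi>. val \<pi> \<psi> - val Stop \<psi>)"
        by (intro controlled_diff controlled_val)
      show "val \<pi> \<psi> - val Stop \<psi> - item_gain p f e \<psi> \<le> after e (\<lambda>\<psi>. val \<pi> \<psi> - val Stop \<psi>) \<psi>"
        if "\<psi> \<in> PR" "e \<in> E" for \<psi> e
        using val_mono[OF that, of \<pi>] item_gain_eq[OF that]
          after_diff[OF controlled_val controlled_val that, of \<pi> Stop] by linarith
      show "val \<pi> \<psi> - val Stop \<psi> \<le> (\<Sum>i\<leftarrow>[1..<Suc b]. best (B i) (d i) \<psi>)" if "\<psi> \<in> PR" for \<psi>
      proof -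
        have "val \<pi> \<psi> - val Stop \<psi> \<le> (\<Sum>i\<in>I. best (B i) (d i) \<psi>)"
          using disj sel B_subset by (intro gain_le_sum_best[OF that]) (auto simp: I)
        also have "\<dots> = (\<Sum>i\<leftarrow>[1..<Suc b]. best (B i) (d i) \<psi>)"
          by (subst sum_list_distinct_conv_sum_set)
             (auto simp: I atLeastLessThanSuc_atLeastAtMost simp del: upt_Suc)
        finally show ?thesis .
      qed
    qed (use True in \<open>auto simp: \<alpha>_def empty_PR I\<close>)
    hence "\<alpha> * val \<pi> Map.empty + val Stop Map.empty \<le> (1 + \<alpha>) * greedy_val L Map.empty"
      by (simp add: greedy_gain_def algebra_simps)
    \<comment> \<open>The value of the empty selection is nonnegative and is dropped, and a factor 2
      is given away.\<close>
    hence "\<alpha> * val \<pi> Map.empty \<le> 2 * ((1 + \<alpha>) * greedy_val L Map.empty)"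
      using nonneg \<alpha>1 mult_nonneg_nonneg[of "1 + \<alpha>" "greedy_val L Map.empty"] by linarith
    also have "\<dots> = greedy_val L Map.empty * (2 * (1 + \<alpha>))"
      by (simp only: mult.commute mult.assoc)
    finally have "\<alpha> * val \<pi> Map.empty / (2 * (1 + \<alpha>)) \<le> greedy_val L Map.empty"
      using \<alpha>1 by (simp only: pos_divide_le_eq zero_less_mult_iff zero_less_numeral simp_thms)
    thus ?thesis
      by (simp only: times_divide_eq_left)
  qed
  thus ?thesis
    by (simp only: opt greedy ratio)
qed

end

section \<open>Number of oracle queries\<close>

lemma num_queries_query_all:
  assumes "q \<in> set_pmf (num_queries orc (query_all es \<psi> v k) \<phi>)"
  shows "\<exists>v q'. q = length es + q' \<and> q' \<in> set_pmf (num_queries orc (k v) \<phi>)"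
  using assms
proof (induction es arbitrary: v q)
  case Nil
  thus ?case by auto
next
  case (Cons a es)
  then obtain q1 where "q = Suc q1" "q1 \<in> set_pmf (num_queries orc (query_all es \<psi> (v(a := orc a \<psi>)) k) \<phi>)"
    by auto
  with Cons.IH show ?case by fastforce
qed

lemma num_queries_AToss_sample:
  assumes "q \<in> set_pmf (num_queries orc (AToss (map_pmf h (pmf_of_set Y))) \<phi>)" "finite Y" "Y \<noteq> {}"
  obtains X where "X \<in> Y" "q \<in> set_pmf (num_queries orc (h X) \<phi>)"
proof -
  have "q \<in> (\<Union>X\<in>Y. set_pmf (num_queries orc (h X) \<phi>))"
    using assms by simp
  thus ?thesis
    using that by blast
qed

lemma num_queries_gasg_steps:
  assumes "\<And>i j. (i, j) \<in> set L \<Longrightarrow> finite (B i)"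
    and "q \<in> set_pmf (num_queries orc (gasg_steps B d \<epsilon> tie L \<psi>) \<phi>)"
  shows "q \<le> (\<Sum>(i, j)\<leftarrow>L. sample_size (B i) (d i) \<epsilon>)"
  using assms
proof (induction L arbitrary: q \<psi>)
  case (Cons ij L)
  obtain i j where ij: "ij = (i, j)" by force
  have fin: "finite (B i)" using Cons.prems(1) ij by auto
  have IH: "q \<le> (\<Sum>(i, j)\<leftarrow>L. sample_size (B i) (d i) \<epsilon>)"
    if "q \<in> set_pmf (num_queries orc (gasg_steps B d \<epsilon> tie L \<psi>) \<phi>)" for q \<psi>
    using Cons.IH[OF _ that] Cons.prems(1) by fastforce
  obtain S where "S \<in> {S. S \<subseteq> B i \<and> card S = sample_size (B i) (d i) \<epsilon>}"
    and q: "q \<in> set_pmf (num_queries orc (if S = {} then gasg_steps B d \<epsilon> tie L \<psi>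
            else query_all (SOME es. set es = S \<and> distinct es) \<psi> (\<lambda>_. 0)
              (\<lambda>v. let e = tie i j \<psi> S v
                   in ASelect e (\<lambda>s. gasg_steps B d \<epsilon> tie L (\<psi>(e \<mapsto> s))))) \<phi>)"
    using Cons.prems(2) samples[OF fin] unfolding ij gasg_steps.simps prod.case
    by (rule num_queries_AToss_sample)
  hence S: "S \<subseteq> B i" "card S = sample_size (B i) (d i) \<epsilon>" by simp_all
  show ?case
  proof (cases "S = {}")
    case True
    with q have "q \<in> set_pmf (num_queries orc (gasg_steps B d \<epsilon> tie L \<psi>) \<phi>)"
      by (simp only: simp_thms if_True)
    from IH[OF this] show ?thesis by (simp add: ij)
  next
    case False
    let ?es = "SOME es. set es = S \<and> distinct es"
    have "finite S" using S(1) fin by (rule finite_subset)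
    from set_some_enumeration[OF this] have "length ?es = card S"
      by (metis distinct_card)
    moreover from q False have "q \<in> set_pmf (num_queries orc (query_all ?es \<psi> (\<lambda>_. 0)
              (\<lambda>v. let e = tie i j \<psi> S v
                   in ASelect e (\<lambda>s. gasg_steps B d \<epsilon> tie L (\<psi>(e \<mapsto> s))))) \<phi>)"
      by (simp only: if_False)
    from num_queries_query_all[OF this] obtain v q' where "q = length ?es + q'"
      "q' \<in> set_pmf (num_queries orc (gasg_steps B d \<epsilon> tie L
        (\<psi>(tie i j \<psi> S v \<mapsto> \<phi> (tie i j \<psi> S v)))) \<phi>)"
      unfolding Let_def num_queries.simps by blast
    moreover from IH[OF this(2)] have "q' \<le> (\<Sum>(i, j)\<leftarrow>L. sample_size (B i) (d i) \<epsilon>)" .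
    ultimately show ?thesis
      using S(2) by (simp add: ij)
  qed
qed simp

lemma sum_list_steps:
  "(\<Sum>(i, j)\<leftarrow>[(i, j). i \<leftarrow> is, j \<leftarrow> [1..<Suc (d i)]]. s i) = (\<Sum>i\<leftarrow>is. d i * s i)"
  for s :: "nat \<Rightarrow> nat"
  by (induction "is") (simp_all add: o_def sum_list_triv)

text \<open>Rounding up costs at most one query per step, hence at most \<open>k\<close> in the
  whole group, which is absorbed by \<open>card V\<close>.\<close>

lemma group_queries_le:
  fixes \<epsilon> :: real
  assumes "0 < \<epsilon>" "\<epsilon> < 1" "k \<le> card V"
  shows "real (k * sample_size V k \<epsilon>) \<le> real (card V) * (ln (1 / \<epsilon>) + 1)"
proof (cases "k = 0")
  case False
  let ?x = "real (card V) / real k * ln (1 / \<epsilon>)"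
  have "0 \<le> ?x" using assms by simp
  hence "real (sample_size V k \<epsilon>) \<le> ?x + 1"
    unfolding sample_size_def by linarith
  hence "real k * real (sample_size V k \<epsilon>) \<le> real k * (?x + 1)"
    by (rule mult_left_mono) simp
  also have "\<dots> = real (card V) * ln (1 / \<epsilon>) + real k"
    using False by (simp add: field_simps)
  also have "\<dots> \<le> real (card V) * (ln (1 / \<epsilon>) + 1)"
    using assms by (simp add: distrib_left)
  finally show ?thesis by simp
qed (use assms in simp)

text \<open>The bound of each group is proportional to its size, and the sizes of disjoint groups
  add up to at most \<open>card E\<close>.\<close>

lemma num_queries_gasg:
  fixes \<epsilon> :: real
  assumes E: "finite E" and B: "\<And>i. i \<in> {1..b} \<Longrightarrow> B i \<subseteq> E" and disj: "disjoint_family_on B {1..b}"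
    and d: "\<And>i. i \<in> {1..b} \<Longrightarrow> d i \<le> card (B i)" and \<epsilon>: "0 < \<epsilon>" "\<epsilon> < 1"
    and q: "q \<in> set_pmf (num_queries orc (gasg b B d \<epsilon> tie) \<phi>)"
  shows "real q \<le> real (card E) * (ln (1 / \<epsilon>) + 1)"
proof -
  have fin: "finite (B i)" if "i \<in> {1..b}" for i
    using B[OF that] E by (rule finite_subset)
  have "q \<le> (\<Sum>(i, j)\<leftarrow>[(i, j). i \<leftarrow> [1..<Suc b], j \<leftarrow> [1..<Suc (d i)]]. sample_size (B i) (d i) \<epsilon>)"
    using q unfolding gasg_def by (rule num_queries_gasg_steps[rotated]) (auto intro!: fin)
  also have "\<dots> = (\<Sum>i\<leftarrow>[1..<Suc b]. d i * sample_size (B i) (d i) \<epsilon>)"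
    by (rule sum_list_steps)
  also have "\<dots> = (\<Sum>i\<in>{1..b}. d i * sample_size (B i) (d i) \<epsilon>)"
    by (subst sum_list_distinct_conv_sum_set) (auto simp: atLeastLessThanSuc_atLeastAtMost simp del: upt_Suc)
  finally have "real q \<le> (\<Sum>i\<in>{1..b}. real (d i * sample_size (B i) (d i) \<epsilon>))"
    by (metis of_nat_le_iff of_nat_sum)
  also have "\<dots> \<le> (\<Sum>i\<in>{1..b}. real (card (B i)) * (ln (1 / \<epsilon>) + 1))"
    by (intro sum_mono group_queries_le \<epsilon> d)
  also have "\<dots> = real (card (\<Union>i\<in>{1..b}. B i)) * (ln (1 / \<epsilon>) + 1)"
    using fin disj by (subst card_UN_disjoint) (auto simp: disjoint_family_on_def sum_distrib_right)
  also have "\<dots> \<le> real (card E) * (ln (1 / \<epsilon>) + 1)"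
    using \<epsilon> B by (intro mult_right_mono of_nat_mono card_mono E UN_least) auto
  finally show ?thesis .
qed

theorem theorem6:
  fixes \<epsilon>\<^sub>0 :: real
  assumes "0 < \<epsilon>\<^sub>0" and "\<epsilon>\<^sub>0 < 1"
  shows "\<exists>C::real. \<forall>(E :: 'e set) (Os :: 'o set) (p :: ('e \<Rightarrow> 'o) pmf)
            (f :: 'e set \<Rightarrow> ('e \<Rightarrow> 'o) \<Rightarrow> real) (b :: nat) (B :: nat \<Rightarrow> 'e set) (d :: nat \<Rightarrow> nat)
            (\<epsilon> :: real) (tie :: ('e, 'o) tie_rule).
      finite E \<and> set_pmf p \<subseteq> (E \<rightarrow>\<^sub>E Os) \<and>
      (\<forall>S\<subseteq>E. \<forall>\<phi>\<in>E \<rightarrow>\<^sub>E Os. f S \<phi> \<ge> 0) \<and>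
      (\<forall>S\<subseteq>E. integrable (measure_pmf p) (f S)) \<and>
      fully_adaptive_submodular E Os p f \<and> adaptive_monotone E p f \<and>
      (\<forall>i\<in>{1..b}. B i \<subseteq> E) \<and> disjoint_family_on B {1..b} \<and>
      0 < \<epsilon> \<and> \<epsilon> \<le> \<epsilon>\<^sub>0 \<and> argmax_rule tie
      \<longrightarrow>
      (\<forall>\<pi>opt. is_arg_max (f_avg p f) (\<lambda>\<pi>. \<pi> \<in> feasible_policies E Os b B d) \<pi>opt \<longrightarrow>
         f_avg p f (policy_of (item_gain p f) (gasg b B d \<epsilon> tie))
           \<ge> (1 - 1 / exp 1 - \<epsilon>) / (4 - 2 / exp 1 - 2 * \<epsilon>) * f_avg p f \<pi>opt) \<and>
      ((\<forall>i\<in>{1..b}. d i \<le> card (B i)) \<longrightarrow>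
         (\<forall>\<phi>\<in>E \<rightarrow>\<^sub>E Os. \<forall>q\<in>set_pmf (num_queries (item_gain p f) (gasg b B d \<epsilon> tie) \<phi>).
            real q \<le> C * (real (card E) * ln (1 / \<epsilon>))))"
proof (intro exI[of _ "1 + 1 / ln (1 / \<epsilon>\<^sub>0)"] allI impI conjI ballI, goal_cases)
  case (1 E Os p f b B d \<epsilon> tie \<pi>opt)
  hence adaptive: "adaptive_utility E Os p f"
    by unfold_locales auto
  have "greedy_run E Os p f B \<epsilon> tie {1..b}"
    using adaptive assms 1 by (auto simp: greedy_run_def greedy_run_axioms_def)
  moreover have "\<pi>opt \<in> feasible_policies E Os b B d"
    using 1 by (simp add: is_arg_max_def)
  ultimately show ?case
    using 1 by (intro greedy_run.gasg_ratio[where I="{1..b}"]) auto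
next
  case (2 E Os p f b B d \<epsilon> tie \<phi> q)
  have ln0: "0 < ln (1 / \<epsilon>\<^sub>0)"
    using assms by simp
  have "ln (1 / \<epsilon>\<^sub>0) \<le> ln (1 / \<epsilon>)"
    using 2 assms by (intro ln_mono) (auto simp: frac_le)
  \<comment> \<open>Rounding leaves the summand 1 beside \<open>ln (1 / \<epsilon>)\<close>, which
    tends to 0 as \<open>\<epsilon>\<close> tends to 1. The bound \<open>\<epsilon>\<^sub>0\<close>
    keeps the logarithm away from 0, so 1 is at most
    \<open>ln (1 / \<epsilon>) / ln (1 / \<epsilon>\<^sub>0)\<close>; this gives the
    constant.\<close>
  hence "ln (1 / \<epsilon>) + 1 \<le> (1 + 1 / ln (1 / \<epsilon>\<^sub>0)) * ln (1 / \<epsilon>)"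
    using ln0 by (simp add: distrib_right le_divide_eq)
  hence "real (card E) * (ln (1 / \<epsilon>) + 1) \<le> real (card E) * ((1 + 1 / ln (1 / \<epsilon>\<^sub>0)) * ln (1 / \<epsilon>))"
    by (rule mult_left_mono) simp
  moreover have "real q \<le> real (card E) * (ln (1 / \<epsilon>) + 1)"
    using 2 assms by (intro num_queries_gasg[of E b B d \<epsilon> q "item_gain p f" tie \<phi>]) auto
  ultimately show ?case
    by (simp add: mult_ac)
qed

end
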